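(* Fix a contact structure on $\mathbb{P}^3$ induced by a constant symplectic form on $\mathbb{C}^4$. If $S\subset\mathbb{P}^3$ is a smooth surface of degree $d\ge 3$, then the number of involutive lines contained in $S$ is at most $3d^2-4d$; that is, $\ell_i(d)\le 3d^2-4d$. Moreover, $$ \overline{\ell_i}=\limsup_{d\to\infty}\frac{\ell_i(d)}{d^2}\in[1,3]. $$
   Context: We work over $\mathbb{C}$. A constant symplectic form $\sigma=\sum_{i,j}\lambda_{ij}\,dx_i\wedge dx_j$ on $\mathbb{C}^4$ induces a contact structure on $\mathbb{P}^3$ defined by the contact form $\omega=i_R\sigma\in H^0(\mathbb{P}^3,\Omega^1_{\mathbb{P}^3}(2))$, where $R=\sum_{i=0}^3 x_i\frac{\partial}{\partial x_i}$ is the radial vector field and $i_R$ is interior product with $R$. A line $L\subset\mathbb{P}^3$ is involutive if the pull-back of $\omega$ to $L$ vanishes identically; equivalently, $L$ is the projectivization of a Lagrangian plane of $(\mathbb{C}^4,\sigma)$. For $d\ge 3$, $\ell_i(d)$ denotes the maximal number of involutive lines contained in a smooth surface of degree $d$ in $\mathbb{P}^3$. *)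

theory Defs
  imports "HOL-Analysis.Analysis" "HOL-Library.Poly_Mapping" "HOL-Library.Extended_Real"
begin

text \<open>Projective space: points are the one-dimensional complex subspaces of \<open>\<complex>\<^sup>4\<close>.
  The coordinates \<open>x\<^sub>0, \<dots>, x\<^sub>3\<close> are indexed by the four-element type \<open>4\<close>.\<close>

definition proj_space :: "(complex^4) set set" where
  "proj_space = {P. vec.subspace P \<and> vec.dim P = 1}"

definition projectivization :: "(complex^4) set \<Rightarrow> (complex^4) set set" where
  "projectivization W = {P \<in> proj_space. P \<subseteq> W}"

definition is_plane :: "(complex^4) set \<Rightarrow> bool" where
  "is_plane W \<longleftrightarrow> vec.subspace W \<and> vec.dim W = 2"


text \<open>Constant two-forms \<open>\<Sum>\<^sub>i\<^sub>j \<lambda>\<^sub>i\<^sub>j dx\<^sub>i \<and> dx\<^sub>j\<close>. The sum is over all ordered pairs, and \<open>\<lambda>\<close> need not be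
  skew-symmetric. A constant form is closed, so symplectic means nondegenerate.\<close>

definition two_form :: "complex^4^4 \<Rightarrow> complex^4 \<Rightarrow> complex^4 \<Rightarrow> complex" where
  "two_form lam u v = (\<Sum>i\<in>UNIV. \<Sum>j\<in>UNIV. lam $ i $ j * (u $ i * v $ j - u $ j * v $ i))"

definition symplectic :: "(complex^4 \<Rightarrow> complex^4 \<Rightarrow> complex) \<Rightarrow> bool" where
  "symplectic \<sigma> \<longleftrightarrow> (\<exists>lam. \<sigma> = two_form lam) \<and> (\<forall>u. (\<forall>v. \<sigma> u v = 0) \<longrightarrow> u = 0)"

text \<open>The radial vector field, with \<open>T\<^sub>x \<complex>\<^sup>4\<close> identified with \<open>\<complex>\<^sup>4\<close>.\<close>

definition radial :: "complex^4 \<Rightarrow> complex^4" where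
  "radial x = (\<Sum>i\<in>UNIV. (x $ i) *s axis i 1)"

definition contact_form ::
    "(complex^4 \<Rightarrow> complex^4 \<Rightarrow> complex) \<Rightarrow> complex^4 \<Rightarrow> complex^4 \<Rightarrow> complex" where
  "contact_form \<sigma> x v = \<sigma> (radial x) v"

text \<open>The twisted form on a line is represented by the homogeneous form on the plane \<open>W\<close> over it.
  There \<open>x\<close> is the base point and \<open>v\<close> a vector of \<open>T\<^sub>x W = W\<close>.\<close>

definition involutive_line ::
    "(complex^4 \<Rightarrow> complex^4 \<Rightarrow> complex) \<Rightarrow> (complex^4) set set \<Rightarrow> bool" where
  "involutive_line \<sigma> L \<longleftrightarrow>
     (\<exists>W. is_plane W \<and> L = projectivization W \<and> (\<forall>x\<in>W. \<forall>v\<in>W. contact_form \<sigma> x v = 0))"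


text \<open>Polynomials in \<open>x\<^sub>0, \<dots>, x\<^sub>3\<close>: finitely supported coefficient functions on exponent vectors.\<close>

type_synonym poly4 = "(nat^4) \<Rightarrow>\<^sub>0 complex"

definition eval4 :: "poly4 \<Rightarrow> complex^4 \<Rightarrow> complex" where
  "eval4 F x = (\<Sum>m\<in>Poly_Mapping.keys F. Poly_Mapping.lookup F m * (\<Prod>i\<in>UNIV. (x $ i) ^ (m $ i)))"

text \<open>In the partial derivative, truncated subtraction of exponents only occurs in terms with
  coefficient \<open>0\<close>.\<close>

definition partial4 :: "4 \<Rightarrow> poly4 \<Rightarrow> poly4" where
  "partial4 i F = (\<Sum>m\<in>Poly_Mapping.keys F.
     Poly_Mapping.single (m - axis i 1) (of_nat (m $ i) * Poly_Mapping.lookup F m))"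

definition homogeneous4 :: "nat \<Rightarrow> poly4 \<Rightarrow> bool" where
  "homogeneous4 d F \<longleftrightarrow> (\<forall>m\<in>Poly_Mapping.keys F. (\<Sum>i\<in>UNIV. m $ i) = d)"

definition zero_locus :: "poly4 \<Rightarrow> (complex^4) set set" where
  "zero_locus F = {P \<in> proj_space. \<forall>x\<in>P. eval4 F x = 0}"

text \<open>A form satisfying the Jacobian criterion is squarefree, so \<open>d\<close> is the degree of the reduced
  surface \<open>S\<close>.\<close>

definition smooth_surface :: "nat \<Rightarrow> (complex^4) set set \<Rightarrow> bool" where
  "smooth_surface d S \<longleftrightarrow>
     (\<exists>F. F \<noteq> 0 \<and> homogeneous4 d F \<and> S = zero_locus F \<and>
          (\<forall>x. x \<noteq> 0 \<and> eval4 F x = 0 \<longrightarrow> (\<exists>i. eval4 (partial4 i F) x \<noteq> 0)))"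

definition involutive_lines ::
    "(complex^4 \<Rightarrow> complex^4 \<Rightarrow> complex) \<Rightarrow> (complex^4) set set \<Rightarrow> (complex^4) set set set" where
  "involutive_lines \<sigma> S = {L. involutive_line \<sigma> L \<and> L \<subseteq> S}"

text \<open>Infinite sets are counted as \<open>\<infinity>\<close>, so that a finite bound on the supremum below includes
  finiteness; by discreteness a finite supremum is then a maximum.\<close>

definition ecount :: "'a set \<Rightarrow> enat" where
  "ecount A = (if finite A then enat (card A) else \<infinity>)"

definition max_involutive :: "(complex^4 \<Rightarrow> complex^4 \<Rightarrow> complex) \<Rightarrow> nat \<Rightarrow> enat" where
  "max_involutive \<sigma> d = (SUP S\<in>{S. smooth_surface d S}. ecount (involutive_lines \<sigma> S))"

end

theory Submission
  imports Defs "Jordan_Normal_Form.Determinant" "HOL-Computational_Algebra.Field_as_Ring"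
    "HOL-Computational_Algebra.Fundamental_Theorem_Algebra"
begin

text \<open>
  Let \<open>S\<close> be the smooth surface \<open>F = 0\<close> of degree \<open>d\<close>, and let \<open>X\<close> be the Hamiltonian vector field of \<open>F\<close>,
  defined by \<open>\<sigma>(X, v) = dF(v)\<close>. If a Lagrangian plane \<open>W\<close> lies in the cone over \<open>S\<close>, then \<open>dF\<close> vanishes on
  \<open>W\<close> at every point \<open>x\<close> of \<open>W\<close>. Thus \<open>X(x)\<close> is \<open>\<sigma>\<close>-orthogonal to \<open>W\<close>, which means that it lies in \<open>W\<close>.
  So \<open>F(x + z X(x))\<close> vanishes identically in \<open>z\<close>, and in particular the second derivative
  \<open>G(x) = d\<^sup>2F(X(x), X(x))\<close> vanishes. The form \<open>G\<close> has degree \<open>(d - 2) + 2 (d - 1) = 3d - 4\<close>, all involutive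
  lines of \<open>S\<close> lie in \<open>F = G = 0\<close>, and Bezout's theorem bounds their number by \<open>d (3d - 4)\<close>, provided that \<open>G\<close>
  vanishes on no open piece of \<open>S\<close>.

  This last point is lemma \<open>second_jet_not_zero_on_open_set\<close>. If \<open>G\<close> vanished on an open piece of \<open>S\<close>, then the
  integral curves of \<open>X\<close> there would be straight lines \<open>x + z X(x)\<close> inside \<open>S\<close>, and by moving \<open>x\<close> one could deform
  such a line in \<open>S\<close>. A line in a smooth surface of degree at least \<open>3\<close> has no first-order deformations: with
  \<open>q = X(x)\<close> the field restricts to \<open>X(x + zq) = a(z) x + b(z) q\<close>, where \<open>a\<close> and \<open>b\<close> are binary forms of degree
  \<open>d - 1 \<ge> 2\<close> without common zeros, and a deformation is a relation \<open>a l\<^sub>1 + b l\<^sub>2 = 0\<close> with linear \<open>l\<^sub>1\<close> and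
  \<open>l\<^sub>2\<close>, so that \<open>l\<^sub>1 = l\<^sub>2 = 0\<close>.

  For Bezout's bound (lemma \<open>card_lagrangian_planes_le\<close>) the lines are projected from a general point \<open>c\<close>, which
  keeps them distinct. The resultant of \<open>F\<close> and \<open>G\<close> along the direction \<open>c\<close> vanishes on the projected lines.
  Restricted to a general line \<open>a + t b\<close> it is a polynomial in \<open>t\<close> of degree at most \<open>d (3d - 4)\<close> that has one root
  for each involutive line. It is not the zero polynomial if \<open>F\<close> and \<open>G\<close> have no common zero on the line through
  \<open>a\<close> in direction \<open>c\<close>. Such an \<open>a\<close> exists because the zeros of \<open>G\<close> are nowhere dense in \<open>S\<close>
  (lemma \<open>line_without_common_zero\<close>).

  For the lower bound, the Fermat form in linear coordinates in which \<open>\<sigma>\<close> is the sum of two hyperbolic planes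
  defines a smooth surface. It contains the \<open>d\<^sup>2\<close> lines that join one of its \<open>d\<close> points on the first
  hyperbolic plane to one of its \<open>d\<close> points on the second, and these lines are involutive.
\<close>

section \<open>Resultants of weighted polynomials\<close>

text \<open>A polynomial in \<open>z\<close> over \<open>\<complex>[t]\<close> has weight at most \<open>n\<close> if its total degree in \<open>t\<close> and \<open>z\<close> is at
most \<open>n\<close>.\<close>

definition weight_le :: "nat \<Rightarrow> complex poly poly \<Rightarrow> bool" where
  "weight_le n P \<longleftrightarrow> (\<forall>k. coeff P k \<noteq> 0 \<longrightarrow> degree (coeff P k) + k \<le> n)"

abbreviation specialize :: "complex \<Rightarrow> complex poly poly \<Rightarrow> complex poly" where
  "specialize t \<equiv> map_poly (\<lambda>q. poly q t)"

text \<open>The Sylvester matrix for formal degrees \<open>d\<close> and \<open>m\<close>. Because the size does not depend on the actual degrees, the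
matrix commutes with specialization of the parameter even if a leading coefficient vanishes there.\<close>

definition sylvester :: "nat \<Rightarrow> nat \<Rightarrow> 'a :: comm_ring_1 poly \<Rightarrow> 'a poly \<Rightarrow> 'a mat" where
  "sylvester d m P Q = mat (m + d) (m + d) (\<lambda>(i, j).
     if i < m then (if i \<le> j then coeff P (j - i) else 0)
     else (if i - m \<le> j then coeff Q (j - (i - m)) else 0))"

lemma sylvester_carrier: "sylvester d m P Q \<in> carrier_mat (m + d) (m + d)"
  by (simp add: sylvester_def)

text \<open>Bezout's degree count. Entry \<open>(i, j)\<close> has degree at most \<open>r i - j\<close>, where \<open>r i\<close> is the weight of the shifted
polynomial in row \<open>i\<close>. In a product over a permutation the column indices always sum to \<open>0 + \<dots> + (m + d - 1)\<close>,
and the surplus of the row weights over this sum is \<open>d * m\<close>.\<close>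

lemma degree_det_sylvester:
  assumes P: "weight_le d P" and Q: "weight_le m Q"
  shows "degree (det (sylvester d m P Q)) \<le> d * m"
proof -
  let ?n = "m + d"
  let ?A = "sylvester d m P Q"
  define r where "r i = (if i < m then d + i else i)" for i
  have entry: "degree (?A $$ (i, j)) + j \<le> r i" if "i < ?n" "j < ?n" "?A $$ (i, j) \<noteq> 0" for i j
  proof (cases "i < m")
    case True
    then have "i \<le> j" "coeff P (j - i) \<noteq> 0" "?A $$ (i, j) = coeff P (j - i)"
      using that by (auto simp: sylvester_def split: if_splits)
    with P have "degree (?A $$ (i, j)) + (j - i) \<le> d" by (auto simp: weight_le_def)
    with \<open>i \<le> j\<close> True show ?thesis by (simp add: r_def)
  next
    case False
    then have "i - m \<le> j" "coeff Q (j - (i - m)) \<noteq> 0" "?A $$ (i, j) = coeff Q (j - (i - m))"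
      using that by (auto simp: sylvester_def split: if_splits)
    with Q have "degree (?A $$ (i, j)) + (j - (i - m)) \<le> m" by (auto simp: weight_le_def)
    with \<open>i - m \<le> j\<close> False show ?thesis by (simp add: r_def)
  qed
  have sum_r: "(\<Sum>i<?n. r i) = d * m + (\<Sum>i<?n. i)"
  proof -
    have "r i = (if i \<in> {..<m} then d else 0) + i" for i by (simp add: r_def)
    then have "(\<Sum>i<?n. r i) = (\<Sum>i<?n. if i \<in> {..<m} then d else 0) + (\<Sum>i<?n. i)"
      by (simp only: sum.distrib)
    also have "(\<Sum>i<?n. if i \<in> {..<m} then d else 0) = (\<Sum>i\<in>{..<?n} \<inter> {..<m}. d)"
      by (rule sum.inter_restrict [symmetric]) simp
    also have "{..<?n} \<inter> {..<m} = {..<m}" by auto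
    finally show ?thesis by simp
  qed
  have "degree (signof p * (\<Prod>i = 0..<?n. ?A $$ (i, p i))) \<le> d * m" if p: "p permutes {0..<?n}" for p
  proof (cases "\<exists>i<?n. ?A $$ (i, p i) = 0")
    case True
    then have "(\<Prod>i = 0..<?n. ?A $$ (i, p i)) = 0" by (intro prod_zero) auto
    then show ?thesis by (simp only: mult_zero_right degree_0 zero_le)
  next
    case False
    have lt: "p i < ?n" if "i < ?n" for i
      using permutes_in_image [OF p, of i] that by auto
    have "degree (\<Prod>i = 0..<?n. ?A $$ (i, p i)) \<le> (\<Sum>i = 0..<?n. degree (?A $$ (i, p i)))"
      by (rule order.trans [OF degree_prod_sum_le]) auto
    moreover have "(\<Sum>i = 0..<?n. degree (?A $$ (i, p i))) + (\<Sum>i = 0..<?n. p i) \<le> (\<Sum>i = 0..<?n. r i)"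
      unfolding sum.distrib [symmetric] by (intro sum_mono entry) (use lt False in auto)
    moreover have "(\<Sum>i = 0..<?n. p i) = (\<Sum>i = 0..<?n. i)"
      using sum.permute [OF p, of "\<lambda>i. i"] by (simp add: comp_def)
    ultimately have *: "degree (\<Prod>i = 0..<?n. ?A $$ (i, p i)) \<le> d * m"
      using sum_r by (simp add: atLeast0LessThan)
    have "degree (signof p :: complex poly) = 0" by (simp add: sign_def)
    with * show ?thesis
      using degree_mult_le [of "signof p" "\<Prod>i = 0..<?n. ?A $$ (i, p i)"] by linarith
  qed
  then show ?thesis
    unfolding det_def'[OF sylvester_carrier] by (intro degree_sum_le) (auto simp: finite_permutations)
qed

lemma sum_shifted:
  fixes f :: "nat \<Rightarrow> 'a :: comm_monoid_add"
  shows "(\<Sum>j<n. if i \<le> j then f (j - i) else 0) = (\<Sum>j<n - i. f j)"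
proof -
  have "(\<Sum>j<n. if i \<le> j then f (j - i) else 0) = (\<Sum>j\<in>{j\<in>{..<n}. i \<le> j}. f (j - i))"
    by (rule sum.inter_filter [symmetric]) simp
  also have "\<dots> = (\<Sum>j<n - i. f j)"
    by (rule sum.reindex_bij_witness [of _ "\<lambda>j. j + i" "\<lambda>j. j - i"]) auto
  finally show ?thesis .
qed

lemma sum_lessThan_add:
  fixes f :: "nat \<Rightarrow> 'a :: comm_monoid_add"
  shows "(\<Sum>i<m + d. f i) = (\<Sum>i<m. f i) + (\<Sum>i<d. f (m + i))"
  by (induction d) (simp_all add: add.assoc)

lemma poly_as_sum_lessThan:
  fixes P :: "complex poly"
  assumes "degree P < n"
  shows "poly P z = (\<Sum>j<n. coeff P j * z ^ j)"
proof -
  have "poly P z = (\<Sum>j\<le>degree P. coeff P j * z ^ j)" by (simp add: poly_altdef)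
  also have "\<dots> = (\<Sum>j<n. coeff P j * z ^ j)"
    by (rule sum.mono_neutral_left) (use assms in \<open>auto simp: coeff_eq_0\<close>)
  finally show ?thesis .
qed

text \<open>The vector of powers of a common root is in the kernel of the Sylvester matrix.\<close>

lemma det_sylvester_common_root:
  fixes P Q :: "complex poly"
  assumes deg: "degree P \<le> d" "degree Q \<le> m" "0 < m + d" and z: "poly P z = 0" "poly Q z = 0"
  shows "det (sylvester d m P Q) = 0"
proof -
  let ?n = "m + d" and ?A = "sylvester d m P Q"
  let ?v = "vec ?n (\<lambda>j. z ^ j)"
  have shift: "(\<Sum>j<?n. (if i \<le> j then coeff R (j - i) else 0) * z ^ j) = 0"
    if "degree R + i < ?n" "poly R z = 0" for R i
  proof -
    have "(\<Sum>j<?n. (if i \<le> j then coeff R (j - i) else 0) * z ^ j)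
        = (\<Sum>j<?n. if i \<le> j then z ^ i * (coeff R (j - i) * z ^ (j - i)) else 0)"
      by (intro sum.cong) (auto simp flip: power_add)
    also have "\<dots> = (\<Sum>j<?n - i. z ^ i * (coeff R j * z ^ j))" by (rule sum_shifted)
    also have "\<dots> = z ^ i * poly R z"
      using that(1) by (subst poly_as_sum_lessThan [of R "?n - i"]) (auto simp: sum_distrib_left)
    finally show ?thesis using that(2) by simp
  qed
  have "?A *\<^sub>v ?v = 0\<^sub>v ?n"
  proof (rule eq_vecI)
    fix i assume "i < dim_vec (0\<^sub>v ?n :: complex vec)"
    then have i: "i < ?n" by simp
    have "(?A *\<^sub>v ?v) $ i = (\<Sum>j<?n. ?A $$ (i, j) * z ^ j)"
      using i by (simp add: sylvester_def scalar_prod_def atLeast0LessThan)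
    also have "\<dots> = 0"
    proof (cases "i < m")
      case True
      then show ?thesis using shift [of P i] deg z i by (simp add: sylvester_def)
    next
      case False
      then show ?thesis using shift [of Q "i - m"] deg z i by (simp add: sylvester_def)
    qed
    finally show "(?A *\<^sub>v ?v) $ i = 0\<^sub>v ?n $ i" using i by simp
  qed (simp add: sylvester_def)
  moreover have "?v \<noteq> 0\<^sub>v ?n"
  proof
    assume "?v = 0\<^sub>v ?n"
    then have "?v $ 0 = 0\<^sub>v ?n $ 0" by simp
    with deg(3) show False by simp
  qed
  ultimately show ?thesis
    using det_0_iff_vec_prod_zero [OF sylvester_carrier] by (metis vec_carrier)
qed

lemma coprime_if_no_common_root:
  fixes P Q :: "complex poly"
  assumes "P \<noteq> 0" "\<And>z. \<not> (poly P z = 0 \<and> poly Q z = 0)"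
  shows "coprime P Q"
proof (rule coprimeI)
  fix c assume c: "c dvd P" "c dvd Q"
  have "c \<noteq> 0" using c(1) assms(1) by auto
  have "degree c = 0"
  proof (rule ccontr)
    assume "degree c \<noteq> 0"
    then obtain z where "poly c z = 0"
      using fundamental_theorem_of_algebra [of c] by (auto simp: constant_degree)
    with c assms(2) show False by (metis dvd_trans poly_eq_0_iff_dvd)
  qed
  with \<open>c \<noteq> 0\<close> show "is_unit c" by (simp add: is_unit_iff_degree)
qed

lemma coeff_mult_sum_shift:
  fixes P H :: "'a :: comm_ring_1 poly"
  assumes "\<And>k. n \<le> k \<Longrightarrow> coeff H k = 0"
  shows "coeff (H * P) j = (\<Sum>i<n. coeff H i * (if i \<le> j then coeff P (j - i) else 0))"
proof -
  have "coeff (H * P) j = (\<Sum>i\<le>j. coeff H i * coeff P (j - i))" by (rule coeff_mult)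
  also have "\<dots> = (\<Sum>i\<in>{..j} \<union> {..<n}. coeff H i * (if i \<le> j then coeff P (j - i) else 0))"
    by (rule sum.mono_neutral_cong_left) auto
  also have "\<dots> = (\<Sum>i<n. coeff H i * (if i \<le> j then coeff P (j - i) else 0))"
    by (rule sum.mono_neutral_cong_right) (use assms in auto)
  finally show ?thesis .
qed

text \<open>A vector in the left kernel is a relation \<open>H * P + K * Q = 0\<close> with \<open>H\<close> and \<open>K\<close> of degrees below \<open>m\<close> and
\<open>d\<close>. Since \<open>P\<close> and \<open>Q\<close> are coprime, \<open>P\<close> divides \<open>K\<close>, which is impossible for
degree reasons unless \<open>H = K = 0\<close>.\<close>

lemma det_sylvester_nonzero:
  fixes P Q :: "complex poly"
  assumes P: "coeff P d \<noteq> 0" "degree P \<le> d" and Q: "degree Q \<le> m" and nm: "0 < m + d"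
    and no: "\<And>z. \<not> (poly P z = 0 \<and> poly Q z = 0)"
  shows "det (sylvester d m P Q) \<noteq> 0"
proof
  let ?n = "m + d" and ?A = "sylvester d m P Q"
  assume "det ?A = 0"
  then have "det (transpose_mat ?A) = 0" by (simp add: det_transpose [OF sylvester_carrier])
  then obtain u where u: "u \<in> carrier_vec ?n" "u \<noteq> 0\<^sub>v ?n" "transpose_mat ?A *\<^sub>v u = 0\<^sub>v ?n"
    using det_0_iff_vec_prod_zero [OF transpose_carrier_mat [THEN iffD2, OF sylvester_carrier [of d m P Q]]] by blast
  define H where "H = (\<Sum>i<m. monom (u $ i) i)"
  define K where "K = (\<Sum>i<d. monom (u $ (m + i)) i)"
  have cH: "coeff H i = (if i < m then u $ i else 0)" for i
    by (simp add: H_def coeff_sum sum.delta if_distrib cong: if_cong)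
  have cK: "coeff K i = (if i < d then u $ (m + i) else 0)" for i
    by (simp add: K_def coeff_sum sum.delta if_distrib cong: if_cong)
  have zero_H: "coeff H k = 0" if "m \<le> k" for k using that by (simp add: cH)
  have zero_K: "coeff K k = 0" if "d \<le> k" for k using that by (simp add: cK)
  have dP: "degree P = d" using P le_degree [of P d] by simp
  have "H * P + K * Q = 0"
  proof (rule poly_eqI)
    fix j
    show "coeff (H * P + K * Q) j = coeff 0 j"
    proof (cases "j < ?n")
      case True
      have "0 = (transpose_mat ?A *\<^sub>v u) $ j" using u True by simp
      also have "\<dots> = (\<Sum>i<?n. ?A $$ (i, j) * u $ i)"
        using True u(1) by (simp add: sylvester_def scalar_prod_def atLeast0LessThan)
      also have "\<dots> = (\<Sum>i<m. ?A $$ (i, j) * u $ i) + (\<Sum>i<d. ?A $$ (m + i, j) * u $ (m + i))"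
        by (rule sum_lessThan_add)
      also have "\<dots> = coeff (H * P) j + coeff (K * Q) j"
      proof -
        have "(\<Sum>i<m. ?A $$ (i, j) * u $ i) = coeff (H * P) j"
        proof -
          have "coeff (H * P) j = (\<Sum>i<m. coeff H i * (if i \<le> j then coeff P (j - i) else 0))"
            by (rule coeff_mult_sum_shift) (rule zero_H)
          also have "\<dots> = (\<Sum>i<m. ?A $$ (i, j) * u $ (i))"
            by (rule sum.cong) (use True in \<open>simp_all add: cH sylvester_def mult.commute\<close>)
          finally show ?thesis by simp
        qed
        moreover have "(\<Sum>i<d. ?A $$ (m + i, j) * u $ (m + i)) = coeff (K * Q) j"
        proof -
          have "coeff (K * Q) j = (\<Sum>i<d. coeff K i * (if i \<le> j then coeff Q (j - i) else 0))"
            by (rule coeff_mult_sum_shift) (rule zero_K)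
          also have "\<dots> = (\<Sum>i<d. ?A $$ (m + i, j) * u $ (m + i))"
            by (rule sum.cong) (use True in \<open>simp_all add: cK sylvester_def mult.commute\<close>)
          finally show ?thesis by simp
        qed
        ultimately show ?thesis by simp
      qed
      finally show ?thesis by simp
    next
      case False
      have "coeff (H * P) j = 0" unfolding coeff_mult
      proof (intro sum.neutral ballI)
        fix i assume "i \<in> {..j}"
        show "coeff H i * coeff P (j - i) = 0"
          using False P(2) by (cases "i < m") (simp_all add: cH coeff_eq_0)
      qed
      moreover have "coeff (K * Q) j = 0" unfolding coeff_mult
      proof (intro sum.neutral ballI)
        fix i assume "i \<in> {..j}"
        show "coeff K i * coeff Q (j - i) = 0"
          using False Q by (cases "i < d") (simp_all add: cK coeff_eq_0)
      qed
      ultimately show ?thesis by simp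
    qed
  qed
  then have "K * Q = - H * P" by (simp add: algebra_simps add_eq_0_iff)
  then have "P dvd K * Q" by simp
  moreover have "P \<noteq> 0" using P by auto
  then have "coprime P Q" using no by (rule coprime_if_no_common_root)
  ultimately have "P dvd K" by (simp add: coprime_dvd_mult_left_iff)
  moreover have "K = 0 \<or> degree K < d"
    by (cases "K = 0") (auto intro!: degree_lessI simp: cK)
  ultimately have "K = 0" using dP dvd_imp_degree_le [of P K] by linarith
  with \<open>K * Q = - H * P\<close> \<open>P \<noteq> 0\<close> have "H = 0" by simp
  have "u = 0\<^sub>v ?n"
  proof (rule eq_vecI)
    fix i assume "i < dim_vec (0\<^sub>v ?n :: complex vec)"
    then have "i < ?n" by simp
    moreover have "u $ i = 0" if "i < m" using cH [of i] \<open>H = 0\<close> that by simp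
    moreover have "u $ i = 0" if "m \<le> i" "i < ?n"
    proof -
      have "i - m < d" "m + (i - m) = i" using that by linarith+
      then show ?thesis using cK [of "i - m"] \<open>K = 0\<close> by simp
    qed
    ultimately show "u $ i = 0\<^sub>v ?n $ i" by (cases "i < m") auto
  qed (use u in simp)
  with u show False by simp
qed

lemma coeff_specialize: "coeff (specialize t P) k = poly (coeff P k) t"
  by (simp add: coeff_map_poly)

lemma det_sylvester_specialize:
  "det (sylvester d m (specialize t P) (specialize t Q)) = poly (det (sylvester d m P Q)) t"
proof -
  interpret comm_ring_hom "\<lambda>q :: complex poly. poly q t" by unfold_locales auto
  have "sylvester d m (specialize t P) (specialize t Q) = map_mat (\<lambda>q. poly q t) (sylvester d m P Q)"
    by (rule eq_matI) (auto simp: sylvester_def coeff_specialize)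
  then show ?thesis by (simp only: hom_det)
qed

text \<open>Bezout's theorem in the plane, in the form needed here: if two plane curves of degrees \<open>d\<close> and \<open>m\<close> do not meet on
the line \<open>t = 0\<close>, and the first one does not pass through the point at infinity in direction \<open>z\<close>, then at most
\<open>d * m\<close> lines \<open>t = const\<close> contain a common point.\<close>

lemma card_common_root_parameters:
  fixes P Q :: "complex poly poly"
  assumes P: "weight_le d P" "coeff P d \<noteq> 0" and Q: "weight_le m Q"
    and no: "\<And>z. \<not> (poly (specialize 0 P) z = 0 \<and> poly (specialize 0 Q) z = 0)"
    and T: "\<And>t. t \<in> T \<Longrightarrow> \<exists>z. poly (specialize t P) z = 0 \<and> poly (specialize t Q) z = 0"
  shows "card T \<le> d * m"
proof -
  have "degree (coeff P d) = 0" using P by (auto simp: weight_le_def)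
  \<comment> \<open>the weight bound makes the leading coefficient a constant, so it survives every specialization\<close>
  then have lead: "poly (coeff P d) t \<noteq> 0" for t
    using P(2) by (auto elim!: degree_eq_zeroE)
  show ?thesis
  proof (cases "d = 0")
    case True
    have "coeff P k = 0" if "k \<noteq> 0" for k using P(1) True that by (auto simp: weight_le_def)
    then have "specialize t P = [:poly (coeff P 0) t:]" for t
      by (intro poly_eqI) (auto simp: coeff_specialize coeff_pCons split: nat.split)
    then have nz: "poly (specialize t P) z \<noteq> 0" for t z
      using lead [of t] True by simp
    have "T = {}"
    proof (rule ccontr)
      assume "T \<noteq> {}"
      then obtain t where "t \<in> T" by blast
      from T [OF this] nz show False by blast
    qed
    then show ?thesis by simp
  next
    case False
    define R where "R = det (sylvester d m P Q)"
    have deg: "degree (specialize t S) \<le> n" if "weight_le n S" for t S n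
    proof (intro degree_le allI impI)
      fix i assume "n < i"
      with that have "coeff S i = 0" by (auto simp: weight_le_def)
      then show "coeff (specialize t S) i = 0" by (simp add: coeff_specialize)
    qed
    have "poly R 0 \<noteq> 0"
      unfolding R_def det_sylvester_specialize [symmetric]
      by (rule det_sylvester_nonzero) (use deg P Q no lead False in \<open>auto simp: coeff_specialize\<close>)
    then have "R \<noteq> 0" by auto
    have "poly R t = 0" if "t \<in> T" for t
      unfolding R_def det_sylvester_specialize [symmetric]
      using T [OF that] deg P Q False by (auto intro: det_sylvester_common_root)
    then have "card T \<le> card {t. poly R t = 0}"
      using \<open>R \<noteq> 0\<close> by (intro card_mono poly_roots_finite) auto
    also have "\<dots> \<le> degree R" using \<open>R \<noteq> 0\<close> by (rule card_poly_roots_bound)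
    also have "\<dots> \<le> d * m" unfolding R_def using P(1) Q by (rule degree_det_sylvester)
    finally show ?thesis .
  qed
qed

section \<open>Forms in four variables\<close>

text \<open>From here on \<open>$\<close> denotes the components of vectors in \<open>\<complex>\<^sup>4\<close>.\<close>

no_notation Matrix.vec_index (infixl "$" 100)

definition mon :: "nat^4 \<Rightarrow> complex^4 \<Rightarrow> complex" where
  "mon m x = (\<Prod>i\<in>UNIV. (x $ i) ^ (m $ i))"

lemma eval4_superset:
  assumes "finite A" "Poly_Mapping.keys F \<subseteq> A"
  shows "eval4 F x = (\<Sum>m\<in>A. Poly_Mapping.lookup F m * mon m x)"
  unfolding eval4_def mon_def
  by (rule sum.mono_neutral_left) (use assms in \<open>auto simp: in_keys_iff\<close>)

lemma eval4_0 [simp]: "eval4 0 x = 0"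
  by (simp add: eval4_def)

lemma eval4_add: "eval4 (F + G) x = eval4 F x + eval4 G x"
proof -
  let ?A = "Poly_Mapping.keys F \<union> Poly_Mapping.keys G"
  have "eval4 (F + G) x = (\<Sum>m\<in>?A. Poly_Mapping.lookup (F + G) m * mon m x)"
    by (rule eval4_superset) (auto simp: in_keys_iff lookup_add)
  also have "\<dots> = (\<Sum>m\<in>?A. Poly_Mapping.lookup F m * mon m x) + (\<Sum>m\<in>?A. Poly_Mapping.lookup G m * mon m x)"
    by (simp add: lookup_add algebra_simps sum.distrib)
  finally show ?thesis
    using eval4_superset [of ?A F x] eval4_superset [of ?A G x] by simp
qed

lemma eval4_sum: "eval4 (\<Sum>a\<in>A. F a) x = (\<Sum>a\<in>A. eval4 (F a) x)"
  by (induction A rule: infinite_finite_induct) (simp_all add: eval4_add)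

lemma eval4_single: "eval4 (Poly_Mapping.single m c) x = c * mon m x"
  by (subst eval4_superset [of "{m}"]) auto

lemma eval4_partial4:
  "eval4 (partial4 i F) x =
    (\<Sum>m\<in>Poly_Mapping.keys F. of_nat (m $ i) * Poly_Mapping.lookup F m * mon (m - axis i 1) x)"
  by (simp add: partial4_def eval4_sum eval4_single)

lemma mon_minus_axis: "mon (m - axis i 1) x = (x $ i) ^ (m $ i - 1) * (\<Prod>j\<in>UNIV - {i}. (x $ j) ^ (m $ j))"
proof -
  have "mon (m - axis i 1) x = (x $ i) ^ ((m - axis i 1) $ i) * (\<Prod>j\<in>UNIV - {i}. (x $ j) ^ ((m - axis i 1) $ j))"
    unfolding mon_def by (rule prod.remove) auto
  also have "(\<Prod>j\<in>UNIV - {i}. (x $ j) ^ ((m - axis i 1) $ j)) = (\<Prod>j\<in>UNIV - {i}. (x $ j) ^ (m $ j))"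
    by (rule prod.cong) (auto simp: axis_def)
  finally show ?thesis by (simp add: axis_def)
qed

lemma coordinate_times_mon: "x $ i * (of_nat (m $ i) * mon (m - axis i 1) x) = of_nat (m $ i) * mon m x"
proof (cases "m $ i = 0")
  case False
  have "mon m x = (x $ i) ^ (m $ i) * (\<Prod>j\<in>UNIV - {i}. (x $ j) ^ (m $ j))"
    unfolding mon_def by (rule prod.remove) auto
  moreover obtain k where "m $ i = Suc k" using False not0_implies_Suc by blast
  ultimately show ?thesis
    by (simp add: mon_minus_axis mult_ac del: One_nat_def)
qed simp

lemma has_derivative_nth: "((\<lambda>x :: complex^4. x $ i) has_derivative (\<lambda>v. v $ i)) (at x within S)"
  by (rule bounded_linear_imp_has_derivative [OF bounded_linear_vec_nth])

lemma has_derivative_mon: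
  "(mon m has_derivative (\<lambda>v. \<Sum>i\<in>UNIV. v $ i * (of_nat (m $ i) * mon (m - axis i 1) x))) (at x)"
proof -
  have "((\<lambda>x. \<Prod>i\<in>UNIV. (x $ i) ^ (m $ i)) has_derivative
      (\<lambda>v. \<Sum>i\<in>UNIV. (of_nat (m $ i) * v $ i * x $ i ^ (m $ i - 1)) * (\<Prod>j\<in>UNIV - {i}. (x $ j) ^ (m $ j)))) (at x)"
    by (intro has_derivative_prod has_derivative_power has_derivative_nth)
  also have "(\<lambda>x. \<Prod>i\<in>UNIV. (x $ i) ^ (m $ i)) = mon m"
    by (auto simp: mon_def)
  also have "(\<lambda>v. \<Sum>i\<in>UNIV. (of_nat (m $ i) * v $ i * x $ i ^ (m $ i - 1)) * (\<Prod>j\<in>UNIV - {i}. (x $ j) ^ (m $ j)))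
      = (\<lambda>v. \<Sum>i\<in>UNIV. v $ i * (of_nat (m $ i) * mon (m - axis i 1) x))"
    by (simp add: mon_minus_axis mult_ac del: One_nat_def)
  finally show ?thesis .
qed

lemma has_derivative_eval4:
  "(eval4 F has_derivative (\<lambda>v. \<Sum>i\<in>UNIV. v $ i * eval4 (partial4 i F) x)) (at x)"
proof -
  have "((\<lambda>x. \<Sum>m\<in>Poly_Mapping.keys F. Poly_Mapping.lookup F m * mon m x) has_derivative
     (\<lambda>v. \<Sum>m\<in>Poly_Mapping.keys F. Poly_Mapping.lookup F m *
        (\<Sum>i\<in>UNIV. v $ i * (of_nat (m $ i) * mon (m - axis i 1) x)))) (at x)"
    by (intro has_derivative_sum has_derivative_mult_right has_derivative_mon)
  moreover have "(\<lambda>x. \<Sum>m\<in>Poly_Mapping.keys F. Poly_Mapping.lookup F m * mon m x) = eval4 F"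
    by (auto simp: eval4_def mon_def)
  moreover have "(\<Sum>m\<in>Poly_Mapping.keys F. Poly_Mapping.lookup F m *
        (\<Sum>i\<in>UNIV. v $ i * (of_nat (m $ i) * mon (m - axis i 1) x)))
      = (\<Sum>i\<in>UNIV. v $ i * eval4 (partial4 i F) x)" for v
    unfolding eval4_partial4 sum_distrib_left
    by (subst sum.swap) (simp add: mult_ac)
  ultimately show ?thesis by simp
qed

lemma lookup_partial4:
  "Poly_Mapping.lookup (partial4 i F) m = of_nat (m $ i + 1) * Poly_Mapping.lookup F (m + axis i 1)"
proof -
  have shift: "k - axis i 1 = m \<longleftrightarrow> k = m + axis i 1" if "k $ i \<noteq> 0" for k :: "nat^4"
  proof
    assume "k - axis i 1 = m"
    then have "m $ j = k $ j - (if j = i then 1 else 0)" for j by (auto simp: axis_def)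
    with that show "k = m + axis i 1" by (auto simp: Finite_Cartesian_Product.vec_eq_iff axis_def)
  qed (simp add: Finite_Cartesian_Product.vec_eq_iff axis_def)
  have "Poly_Mapping.lookup (partial4 i F) m
      = (\<Sum>k\<in>Poly_Mapping.keys F. if k - axis i 1 = m then of_nat (k $ i) * Poly_Mapping.lookup F k else 0)"
    by (simp add: partial4_def lookup_sum lookup_single when_def)
  also have "\<dots> = (\<Sum>k\<in>Poly_Mapping.keys F. if k = m + axis i 1 then of_nat (k $ i) * Poly_Mapping.lookup F k else 0)"
    by (rule sum.cong) (use shift in \<open>auto simp: axis_def\<close>)
  also have "\<dots> = of_nat (m $ i + 1) * Poly_Mapping.lookup F (m + axis i 1)"
    by (simp add: sum.delta' sum.delta axis_def in_keys_iff)
  finally show ?thesis .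
qed

lemma partial4_commute: "partial4 i (partial4 j F) = partial4 j (partial4 i F)"
proof (rule poly_mapping_eqI)
  fix m
  show "Poly_Mapping.lookup (partial4 i (partial4 j F)) m = Poly_Mapping.lookup (partial4 j (partial4 i F)) m"
    by (cases "i = j") (simp_all add: lookup_partial4 axis_def add_ac)
qed

lemma homogeneous4_partial4:
  assumes "homogeneous4 d F"
  shows "homogeneous4 (d - 1) (partial4 i F)"
  unfolding homogeneous4_def
proof
  fix m assume "m \<in> Poly_Mapping.keys (partial4 i F)"
  then have "m + axis i 1 \<in> Poly_Mapping.keys F"
    by (auto simp: in_keys_iff lookup_partial4)
  with assms have "(\<Sum>j\<in>UNIV. (m + axis i 1) $ j) = d" by (auto simp: homogeneous4_def)
  moreover have "(\<Sum>j\<in>UNIV. (m + axis i 1) $ j) = (\<Sum>j\<in>UNIV. m $ j) + 1"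
    by (simp add: sum.distrib axis_def sum.delta)
  ultimately show "(\<Sum>j\<in>UNIV. m $ j) = d - 1" by simp
qed

text \<open>Each monomial satisfies \<open>x\<^sub>i \<partial>\<^sub>i x\<^sup>m = m\<^sub>i x\<^sup>m\<close>, and the exponents sum to \<open>d\<close>.\<close>

lemma Euler_identity:
  assumes "homogeneous4 d F"
  shows "(\<Sum>i\<in>UNIV. x $ i * eval4 (partial4 i F) x) = of_nat d * eval4 F x"
proof -
  have "(\<Sum>i\<in>UNIV. x $ i * eval4 (partial4 i F) x)
      = (\<Sum>m\<in>Poly_Mapping.keys F. \<Sum>i\<in>UNIV. Poly_Mapping.lookup F m * (x $ i * (of_nat (m $ i) * mon (m - axis i 1) x)))"
    unfolding eval4_partial4 sum_distrib_left by (subst sum.swap) (simp add: mult_ac)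
  also have "\<dots> = (\<Sum>m\<in>Poly_Mapping.keys F. \<Sum>i\<in>UNIV. Poly_Mapping.lookup F m * (of_nat (m $ i) * mon m x))"
    by (simp only: coordinate_times_mon)
  also have "\<dots> = (\<Sum>m\<in>Poly_Mapping.keys F. Poly_Mapping.lookup F m * (of_nat d * mon m x))"
    using assms by (intro sum.cong)
      (auto simp: homogeneous4_def simp flip: sum_distrib_left sum_distrib_right of_nat_sum)
  finally show ?thesis by (simp add: eval4_def mon_def sum_distrib_left mult_ac)
qed

lemma eval4_scale:
  assumes "homogeneous4 d F"
  shows "eval4 F (c *s x) = c ^ d * eval4 F x"
proof -
  have "mon m (c *s x) = c ^ (\<Sum>i\<in>UNIV. m $ i) * mon m x" for m
    by (simp add: mon_def power_mult_distrib prod.distrib power_sum)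
  with assms show ?thesis
    unfolding eval4_superset [OF finite_keys order_refl] sum_distrib_left
    by (intro sum.cong) (auto simp: homogeneous4_def)
qed

lemma specialize_altdef: "poly (specialize t P) z = poly (poly P [:z:]) t"
  by (induction P) (simp_all add: map_poly_pCons)

lemma weight_le_add: "weight_le n P \<Longrightarrow> weight_le n Q \<Longrightarrow> weight_le n (P + Q)"
  unfolding weight_le_def
proof (intro allI impI)
  fix k
  assume *: "\<forall>k. coeff P k \<noteq> 0 \<longrightarrow> degree (coeff P k) + k \<le> n" "\<forall>k. coeff Q k \<noteq> 0 \<longrightarrow> degree (coeff Q k) + k \<le> n"
    and "coeff (P + Q) k \<noteq> 0"
  then have "coeff P k \<noteq> 0 \<or> coeff Q k \<noteq> 0" by auto
  moreover have "degree (coeff (P + Q) k) \<le> max (degree (coeff P k)) (degree (coeff Q k))"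
    by (simp add: degree_add_le_max)
  ultimately show "degree (coeff (P + Q) k) + k \<le> n"
    using *(1)[rule_format, of k] *(2)[rule_format, of k] by (cases "coeff P k = 0"; cases "coeff Q k = 0") auto
qed

lemma weight_le_mult:
  assumes "weight_le n P" "weight_le m Q"
  shows "weight_le (n + m) (P * Q)"
  unfolding weight_le_def
proof (intro allI impI)
  fix k assume nz: "coeff (P * Q) k \<noteq> 0"
  have *: "degree (coeff P i * coeff Q (k - i)) + k \<le> n + m" if "i \<le> k" "coeff P i * coeff Q (k - i) \<noteq> 0" for i
  proof -
    have "coeff P i \<noteq> 0" "coeff Q (k - i) \<noteq> 0" using that by auto
    with assms have "degree (coeff P i) + i \<le> n" "degree (coeff Q (k - i)) + (k - i) \<le> m"
      by (auto simp: weight_le_def)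
    with that show ?thesis using degree_mult_le [of "coeff P i" "coeff Q (k - i)"] by linarith
  qed
  have "\<exists>i\<le>k. coeff P i * coeff Q (k - i) \<noteq> 0"
    using nz unfolding coeff_mult by (metis (no_types, lifting) atMost_iff sum.neutral)
  with * have "k \<le> n + m" by (meson add_leE)
  have "degree (coeff (P * Q) k) \<le> n + m - k" unfolding coeff_mult
  proof (rule degree_sum_le)
    fix i assume "i \<in> {..k}"
    then show "degree (coeff P i * coeff Q (k - i)) \<le> n + m - k"
      using * [of i] by (cases "coeff P i * coeff Q (k - i) = 0") auto
  qed simp
  with \<open>k \<le> n + m\<close> show "degree (coeff (P * Q) k) + k \<le> n + m" by simp
qed

lemma coeff_mult_top:
  assumes "weight_le n P" "weight_le m Q"
  shows "coeff (P * Q) (n + m) = coeff P n * coeff Q m"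
proof -
  have "coeff P i * coeff Q (n + m - i) = 0" if "i \<le> n + m" "i \<noteq> n" for i
  proof (cases "i < n")
    case True
    then have "coeff Q (n + m - i) = 0" using assms(2) that by (force simp: weight_le_def)
    then show ?thesis by simp
  next
    case False
    then have "coeff P i = 0" using assms(1) that by (force simp: weight_le_def)
    then show ?thesis by simp
  qed
  then have "(\<Sum>i\<le>n + m. coeff P i * coeff Q (n + m - i)) = (\<Sum>i\<in>{n}. coeff P i * coeff Q (n + m - i))"
    by (intro sum.mono_neutral_right) auto
  then show ?thesis by (simp add: coeff_mult)
qed

text \<open>Functions on \<open>\<complex>\<^sup>4\<close> that behave like forms of degree \<open>d\<close> on every affine plane: the restriction to
\<open>a + t b + z c\<close> is a polynomial of total degree at most \<open>d\<close>, and the coefficient of \<open>z\<^sup>d\<close> is the value at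
the point \<open>c\<close> at infinity. This covers expressions in derivatives of a form, such as the second derivative along the
Hamiltonian field, without naming their coefficients.\<close>

definition hompoly :: "nat \<Rightarrow> (complex^4 \<Rightarrow> complex) \<Rightarrow> bool" where
  "hompoly d f \<longleftrightarrow> (\<forall>a b c. \<exists>P. weight_le d P \<and> coeff P d = [:f c:] \<and>
      (\<forall>t z. f (a + t *s b + z *s c) = poly (specialize t P) z))"

lemma hompoly_add:
  assumes "hompoly d f" "hompoly d g"
  shows "hompoly d (\<lambda>x. f x + g x)"
  unfolding hompoly_def
proof (intro allI)
  fix a b c
  obtain P Q where "weight_le d P" "coeff P d = [:f c:]" "\<forall>t z. f (a + t *s b + z *s c) = poly (specialize t P) z"
    "weight_le d Q" "coeff Q d = [:g c:]" "\<forall>t z. g (a + t *s b + z *s c) = poly (specialize t Q) z"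
    using assms unfolding hompoly_def by metis
  then show "\<exists>P. weight_le d P \<and> coeff P d = [:f c + g c:] \<and>
      (\<forall>t z. f (a + t *s b + z *s c) + g (a + t *s b + z *s c) = poly (specialize t P) z)"
    by (intro exI [of _ "P + Q"]) (auto simp: specialize_altdef weight_le_add)
qed

lemma hompoly_mult:
  assumes "hompoly d f" "hompoly e g"
  shows "hompoly (d + e) (\<lambda>x. f x * g x)"
  unfolding hompoly_def
proof (intro allI)
  fix a b c
  obtain P Q where PQ: "weight_le d P" "coeff P d = [:f c:]" "\<forall>t z. f (a + t *s b + z *s c) = poly (specialize t P) z"
    "weight_le e Q" "coeff Q e = [:g c:]" "\<forall>t z. g (a + t *s b + z *s c) = poly (specialize t Q) z"
    using assms unfolding hompoly_def by metis
  then have "coeff (P * Q) (d + e) = [:f c * g c:]" by (simp add: coeff_mult_top)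
  with PQ show "\<exists>P. weight_le (d + e) P \<and> coeff P (d + e) = [:f c * g c:] \<and>
      (\<forall>t z. f (a + t *s b + z *s c) * g (a + t *s b + z *s c) = poly (specialize t P) z)"
    by (intro exI [of _ "P * Q"]) (auto simp: specialize_altdef weight_le_mult)
qed

lemma hompoly_0: "hompoly d (\<lambda>x. 0)"
  unfolding hompoly_def by (intro allI exI [of _ 0]) (auto simp: weight_le_def)

lemma hompoly_const: "hompoly 0 (\<lambda>x. k)"
  unfolding hompoly_def
  by (intro allI exI [of _ "[:[:k:]:]"]) (auto simp: weight_le_def specialize_altdef coeff_pCons split: nat.splits)

lemma hompoly_cmult: "hompoly d f \<Longrightarrow> hompoly d (\<lambda>x. k * f x)"
  using hompoly_mult [OF hompoly_const] by simp

lemma hompoly_nth: "hompoly 1 (\<lambda>x. x $ i)"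
  unfolding hompoly_def
  by (intro allI, rule_tac x = "[:[:a $ i, b $ i:], [:c $ i:]:]" in exI)
     (auto simp: weight_le_def specialize_altdef coeff_pCons algebra_simps split: nat.splits)

lemma hompoly_sum: "(\<And>k. k \<in> A \<Longrightarrow> hompoly d (f k)) \<Longrightarrow> hompoly d (\<lambda>x. \<Sum>k\<in>A. f k x)"
  by (induction A rule: infinite_finite_induct) (auto simp: hompoly_0 intro: hompoly_add)

lemma hompoly_power: "hompoly d f \<Longrightarrow> hompoly (n * d) (\<lambda>x. f x ^ n)"
  by (induction n) (simp_all add: hompoly_const hompoly_mult)

lemma hompoly_prod:
  "finite A \<Longrightarrow> (\<And>k. k \<in> A \<Longrightarrow> hompoly (d k) (f k)) \<Longrightarrow> hompoly (\<Sum>k\<in>A. d k) (\<lambda>x. \<Prod>k\<in>A. f k x)"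
  by (induction A rule: finite_induct) (simp_all add: hompoly_const hompoly_mult)

lemma hompoly_mon: "hompoly (\<Sum>i\<in>UNIV. m $ i) (mon m)"
proof -
  have "hompoly (m $ i) (\<lambda>x. (x $ i) ^ (m $ i))" for i
    using hompoly_power [OF hompoly_nth [of i], of "m $ i"] by simp
  then have "hompoly (\<Sum>i\<in>UNIV. m $ i) (\<lambda>x. \<Prod>i\<in>UNIV. (x $ i) ^ (m $ i))"
    by (intro hompoly_prod) auto
  then show ?thesis by (simp add: mon_def [abs_def])
qed

lemma hompoly_eval4: "homogeneous4 d F \<Longrightarrow> hompoly d (eval4 F)"
  unfolding eval4_superset [OF finite_keys order_refl, abs_def]
  by (intro hompoly_sum hompoly_cmult) (use hompoly_mon in \<open>fastforce simp: homogeneous4_def\<close>)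

lemma hompoly_line:
  assumes "hompoly d f"
  obtains P where "degree P \<le> d" "coeff P d = f c" "\<And>z. f (a + z *s c) = poly P z"
proof -
  obtain Q where Q: "weight_le d Q" "coeff Q d = [:f c:]" "\<And>t z. f (a + t *s 0 + z *s c) = poly (specialize t Q) z"
    using assms unfolding hompoly_def by metis
  show thesis
  proof (rule that)
    show "degree (specialize 0 Q) \<le> d"
    proof (intro degree_le allI impI)
      fix i assume "d < i"
      with Q(1) have "coeff Q i = 0" by (auto simp: weight_le_def)
      then show "coeff (specialize 0 Q) i = 0" by (simp add: coeff_specialize)
    qed
    show "coeff (specialize 0 Q) d = f c" using Q(2) by (simp add: coeff_specialize)
    show "f (a + z *s c) = poly (specialize 0 Q) z" for z using Q(3)[of 0 z] by simp
  qed
qed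

section \<open>Zeros of forms on nearby lines\<close>

lemma monic_value_lower_bound:
  fixes z :: complex
  assumes "\<forall>x\<in>#A. r \<le> cmod (z - x)" "0 \<le> r"
  shows "r ^ size A \<le> cmod (poly (\<Prod>x\<in>#A. [:- x, 1:]) z)"
  using assms(1)
proof (induction A)
  case (add x A)
  then have "r * r ^ size A \<le> cmod (z - x) * cmod (poly (\<Prod>x\<in>#A. [:- x, 1:]) z)"
    using assms(2) by (intro mult_mono) auto
  also have "\<dots> = cmod (poly ([:- x, 1:] * (\<Prod>x\<in>#A. [:- x, 1:])) z)"
    by (subst poly_mult) (simp add: norm_mult)
  finally show ?case by simp
qed simp

text \<open>The modulus of the value at \<open>z\<close> is that of the leading coefficient times the product of the distances from \<open>z\<close> to
the roots. Thus a small value forces a close root.\<close>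

lemma root_in_disc:
  fixes p :: "complex poly"
  assumes "degree p = d" "cmod (poly p z) < cmod (lead_coeff p) * r ^ d" "0 \<le> r"
  shows "\<exists>x. poly p x = 0 \<and> cmod (z - x) < r"
proof (rule ccontr)
  assume none: "\<not> ?thesis"
  have "p \<noteq> 0" using assms(2) by auto
  then obtain A where A: "size A = degree p" "p = Polynomial.smult (lead_coeff p) (\<Prod>x\<in>#A. [:- x, 1:])"
    using alg_closed_imp_factorization by blast
  have "poly p x = 0" if "x \<in># A" for x
  proof -
    have "[:- x, 1:] dvd (\<Prod>x\<in>#A. [:- x, 1:])" using that by (intro dvd_prod_mset) auto
    then have "poly (\<Prod>x\<in>#A. [:- x, 1:]) x = 0" by (simp add: poly_eq_0_iff_dvd)
    then show ?thesis by (subst A(2)) simp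
  qed
  then have "\<forall>x\<in>#A. r \<le> cmod (z - x)" using none by (meson not_less)
  then have "r ^ d \<le> cmod (poly (\<Prod>x\<in>#A. [:- x, 1:]) z)"
    using monic_value_lower_bound [of A r z] A(1) assms by simp
  then have "cmod (lead_coeff p) * r ^ d \<le> cmod (lead_coeff p * poly (\<Prod>x\<in>#A. [:- x, 1:]) z)"
    by (simp add: norm_mult mult_left_mono)
  also have "\<dots> = cmod (poly p z)" by (subst (3) A(2)) simp
  finally show False using assms(2) by simp
qed

lemma logarithmic_derivative_bound:
  fixes A :: "complex multiset"
  assumes "\<forall>x\<in>#A. r \<le> cmod x" "0 \<le> r"
  shows "r * cmod (poly (pderiv (\<Prod>x\<in>#A. [:- x, 1:])) 0) \<le> real (size A) * cmod (poly (\<Prod>x\<in>#A. [:- x, 1:]) 0)"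
  using assms(1)
proof (induction A)
  case (add x A)
  let ?q = "\<Prod>x\<in>#A. [:- x, 1:]"
  have IH: "r * cmod (poly (pderiv ?q) 0) \<le> real (size A) * cmod (poly ?q 0)"
    using add by auto
  have rx: "r \<le> cmod x" using add.prems by auto
  have "poly (pderiv ([:- x, 1:] * ?q)) 0 = poly ?q 0 - x * poly (pderiv ?q) 0"
    by (subst pderiv_mult) (simp add: pderiv_pCons)
  then have "cmod (poly (pderiv ([:- x, 1:] * ?q)) 0) \<le> cmod (poly ?q 0) + cmod x * cmod (poly (pderiv ?q) 0)"
    using norm_triangle_ineq4 [of "poly ?q 0" "x * poly (pderiv ?q) 0"] by (simp only: norm_mult)
  then have "r * cmod (poly (pderiv ([:- x, 1:] * ?q)) 0) \<le> r * (cmod (poly ?q 0) + cmod x * cmod (poly (pderiv ?q) 0))"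
    using assms(2) by (rule mult_left_mono)
  also have "\<dots> = r * cmod (poly ?q 0) + cmod x * (r * cmod (poly (pderiv ?q) 0))"
    by (simp add: algebra_simps)
  also have "\<dots> \<le> cmod x * cmod (poly ?q 0) + cmod x * (real (size A) * cmod (poly ?q 0))"
    using rx IH by (intro add_mono mult_right_mono mult_left_mono) auto
  also have "\<dots> = real (size (add_mset x A)) * cmod (poly ([:- x, 1:] * ?q) 0)"
    by (subst poly_mult) (simp add: norm_mult algebra_simps)
  finally show ?case by simp
qed simp

text \<open>A quantitative Newton step: the logarithmic derivative at \<open>0\<close> is, up to sign, the sum of at most \<open>n\<close> reciprocals of roots, so the
smallest root is at most \<open>n\<close> times the Newton correction.\<close>

lemma exists_small_root:
  fixes p :: "complex poly"
  assumes "poly (pderiv p) 0 \<noteq> 0" "degree p \<le> n"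
  shows "\<exists>x. poly p x = 0 \<and> cmod x * cmod (poly (pderiv p) 0) \<le> real n * cmod (poly p 0)"
proof -
  have "pderiv p \<noteq> 0" using assms(1) by auto
  then have "p \<noteq> 0" "degree p \<noteq> 0" by (auto simp: pderiv_eq_0_iff)
  let ?Z = "{x. poly p x = 0}"
  have fin: "finite ?Z" using \<open>p \<noteq> 0\<close> by (rule poly_roots_finite)
  have "?Z \<noteq> {}" using \<open>degree p \<noteq> 0\<close> alg_closed_imp_poly_has_root [of p] by auto
  then obtain x where x: "x \<in> ?Z" "\<And>y. y \<in> ?Z \<Longrightarrow> cmod x \<le> cmod y"
    using fin ex_min_if_finite [of "cmod ` ?Z"] by (metis (no_types, lifting) arg_min_if_finite(1) arg_min_least)
  obtain A where A: "size A = degree p" "p = Polynomial.smult (lead_coeff p) (\<Prod>x\<in>#A. [:- x, 1:])"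
    using \<open>p \<noteq> 0\<close> alg_closed_imp_factorization by blast
  let ?q = "\<Prod>x\<in>#A. [:- x, 1:]"
  have "poly p y = 0" if "y \<in># A" for y
  proof -
    have "[:- y, 1:] dvd ?q" using that by (intro dvd_prod_mset) auto
    then have "poly ?q y = 0" by (simp add: poly_eq_0_iff_dvd)
    then show ?thesis by (subst A(2)) simp
  qed
  then have "\<forall>y\<in>#A. cmod x \<le> cmod y" using x(2) by auto
  then have "cmod x * cmod (poly (pderiv ?q) 0) \<le> real (size A) * cmod (poly ?q 0)"
    by (rule logarithmic_derivative_bound) simp
  also have "\<dots> \<le> real n * cmod (poly ?q 0)" using assms(2) A(1) by (intro mult_right_mono) auto
  finally have "cmod (lead_coeff p) * (cmod x * cmod (poly (pderiv ?q) 0)) \<le> cmod (lead_coeff p) * (real n * cmod (poly ?q 0))"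
    by (rule mult_left_mono) simp
  moreover have "cmod (poly (pderiv p) 0) = cmod (lead_coeff p) * cmod (poly (pderiv ?q) 0)"
    by (subst (1) A(2)) (simp only: pderiv_smult poly_smult norm_mult)
  moreover have "cmod (poly p 0) = cmod (lead_coeff p) * cmod (poly ?q 0)"
    by (subst (1) A(2)) (simp only: poly_smult norm_mult)
  ultimately show ?thesis using x(1) by (auto simp: mult_ac)
qed

lemma bounded_linear_vector_scalar: "bounded_linear (\<lambda>z :: complex. z *s (w :: complex^4))"
  unfolding linear_conv_bounded_linear [symmetric]
  by (rule linearI) (auto simp: Finite_Cartesian_Product.vec_eq_iff algebra_simps)

lemma continuous_on_imp_isCont_compose:
  fixes f :: "complex^4 \<Rightarrow> complex" and g :: "'a :: t2_space \<Rightarrow> complex^4"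
  assumes "continuous_on UNIV f" "isCont g a"
  shows "isCont (\<lambda>x. f (g x)) a"
  using assms by (intro isCont_o2 [of a g f]) (simp_all add: continuous_on_eq_continuous_at)

lemma continuous_eval4: "continuous_on S (eval4 F)"
  by (meson has_derivative_eval4 has_derivative_at_withinI has_derivative_continuous continuous_on_eq_continuous_within)

definition differential :: "poly4 \<Rightarrow> complex^4 \<Rightarrow> complex^4 \<Rightarrow> complex" where
  "differential F x v = (\<Sum>i\<in>UNIV. v $ i * eval4 (partial4 i F) x)"

lemma has_derivative_eval4': "(eval4 F has_derivative differential F x) (at x)"
  using has_derivative_eval4 [of F x] by (simp add: differential_def [abs_def])

lemma differential_add: "differential F x (u + v) = differential F x u + differential F x v"
  by (simp add: differential_def algebra_simps sum.distrib)

lemma differential_scale: "differential F x (c *s v) = c * differential F x v"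
  by (simp add: differential_def algebra_simps sum_distrib_left)

lemma pderiv_line:
  assumes "\<And>z. eval4 F (a + z *s w) = poly P z"
  shows "poly (pderiv P) 0 = differential F a w"
proof -
  have 1: "((\<lambda>z. a + z *s w) has_derivative (\<lambda>z. z *s w)) (at 0)"
    by (auto intro!: derivative_eq_intros bounded_linear_imp_has_derivative bounded_linear_vector_scalar)
  have "((\<lambda>z. eval4 F (a + z *s w)) has_derivative (\<lambda>z. differential F a (z *s w))) (at 0)"
    using has_derivative_compose [OF 1, of "eval4 F" "differential F a"] has_derivative_eval4' [of F a] by simp
  then have "(poly P has_field_derivative differential F a w) (at 0)"
    unfolding has_field_derivative_def assms [abs_def] differential_scale by (simp add: mult.commute [of _ "differential F a w"])
  then show ?thesis using DERIV_unique poly_DERIV by blast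
qed

text \<open>A replacement for the implicit function theorem. Near a smooth point \<open>p\<close> of \<open>F = 0\<close> and for a tangent vector
\<open>v\<close>, the point \<open>p + s v\<close> can be corrected to a zero of \<open>F\<close> by adding a multiple \<open>Z s\<close> of a transversal
vector \<open>w\<close>. The Newton step bounds \<open>Z s\<close> by a multiple of \<open>F(p + s v) = o(s)\<close>, so the corrected curve in the
surface still has velocity \<open>v\<close>.\<close>

lemma derivative_vanishes_on_tangent_space:
  fixes h :: "complex^4 \<Rightarrow> complex"
  assumes F: "homogeneous4 d F" and U: "open U" "p \<in> U" and p: "eval4 F p = 0"
    and v: "differential F p v = 0" and w: "differential F p w \<noteq> 0"
    and h: "\<And>x. x \<in> U \<Longrightarrow> eval4 F x = 0 \<Longrightarrow> h x = 0" and dh: "(h has_derivative h') (at p)"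
  shows "h' v = 0"
proof -
  let ?x = "\<lambda>s :: real. p + s *\<^sub>R v"
  have "\<exists>z. differential F (?x s) w \<noteq> 0 \<longrightarrow> eval4 F (?x s + z *s w) = 0 \<and>
      cmod z * cmod (differential F (?x s) w) \<le> real d * cmod (eval4 F (?x s))" for s
  proof -
    obtain P where P: "degree P \<le> d" "\<And>z. eval4 F (?x s + z *s w) = poly P z"
      using hompoly_line [OF hompoly_eval4 [OF F]] by metis
    have "eval4 F (?x s) = poly P 0" using P(2)[of 0] by simp
    with P(1) show ?thesis
      using exists_small_root [of P d] pderiv_line [OF P(2)] P(2) by auto
  qed
  then obtain Z where Z: "\<And>s. differential F (?x s) w \<noteq> 0 \<Longrightarrow> eval4 F (?x s + Z s *s w) = 0 \<and>
      cmod (Z s) * cmod (differential F (?x s) w) \<le> real d * cmod (eval4 F (?x s))"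
    by metis
  have Z0: "Z 0 = 0" using Z [of 0] w p by (auto simp: mult_le_0_iff)
  have x_deriv: "(?x has_derivative (\<lambda>s. s *\<^sub>R v)) (at 0)"
    by (auto intro!: derivative_eq_intros)
  have "((\<lambda>s. eval4 F (?x s)) has_derivative (\<lambda>s. differential F p (s *\<^sub>R v))) (at 0)"
    using has_derivative_compose [OF x_deriv, of "eval4 F" "differential F p"] has_derivative_eval4' [of F p] by simp
  moreover have "differential F p (s *\<^sub>R v) = 0" for s
  proof -
    have "s *\<^sub>R v = complex_of_real s *s v"
      unfolding Finite_Cartesian_Product.vec_eq_iff vector_scaleR_component vector_smult_component
      by (simp add: scaleR_conv_of_real)
    with v show ?thesis by (simp add: differential_scale)
  qed
  ultimately have F_small: "((\<lambda>s. cmod (eval4 F (?x s)) / norm s) \<longlongrightarrow> 0) (at 0)"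
    unfolding has_derivative_at by (simp add: p)
  have cont: "isCont (\<lambda>s. differential F (?x s) w) 0"
    unfolding differential_def
    by (intro continuous_sum continuous_mult continuous_const continuous_on_imp_isCont_compose [OF continuous_eval4])
       (intro continuous_intros)
  define m where "m = cmod (differential F p w) / 2"
  have "m > 0" using w by (simp add: m_def)
  have "((\<lambda>s. cmod (differential F (?x s) w)) \<longlongrightarrow> cmod (differential F p w)) (at 0)"
    using isContD [OF cont] by (intro tendsto_norm) simp
  then have ev_m: "\<forall>\<^sub>F s in at 0. m < cmod (differential F (?x s) w)"
    by (rule order_tendstoD) (use w in \<open>simp add: m_def\<close>)
  have "(Z has_derivative (\<lambda>s. 0)) (at 0)"
    unfolding has_derivative_at
  proof (intro conjI)
    have "((\<lambda>s. (real d / m) * (cmod (eval4 F (?x s)) / norm s)) \<longlongrightarrow> 0) (at 0)"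
      by (rule tendsto_mult_right_zero [OF F_small])
    then show "(\<lambda>s. norm (Z (0 + s) - Z 0 - 0) / norm s) \<midarrow>0\<rightarrow> 0"
    proof (rule Lim_null_comparison [rotated])
      show "\<forall>\<^sub>F s in at 0. norm (norm (Z (0 + s) - Z 0 - 0) / norm s) \<le> (real d / m) * (cmod (eval4 F (?x s)) / norm s)"
        using ev_m
      proof eventually_elim
        case (elim s)
        then have "differential F (?x s) w \<noteq> 0" using \<open>m > 0\<close> by auto
        then have "cmod (Z s) * cmod (differential F (?x s) w) \<le> real d * cmod (eval4 F (?x s))" using Z by blast
        moreover have "cmod (Z s) * m \<le> cmod (Z s) * cmod (differential F (?x s) w)" using elim by (intro mult_left_mono) auto
        ultimately have "cmod (Z s) \<le> real d / m * cmod (eval4 F (?x s))"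
          using \<open>m > 0\<close> by (simp add: field_simps)
        then have "cmod (Z s) / \<bar>s\<bar> \<le> real d / m * cmod (eval4 F (?x s)) / \<bar>s\<bar>" by (rule divide_right_mono) simp
        then show ?case by (simp add: Z0)
      qed
    qed
  qed simp
  then have "((\<lambda>s. Z s *s w) has_derivative (\<lambda>s. 0 *s w)) (at 0)"
    by (rule bounded_linear.has_derivative [OF bounded_linear_vector_scalar])
  then have g_deriv: "((\<lambda>s. ?x s + Z s *s w) has_derivative (\<lambda>s. s *\<^sub>R v)) (at 0)"
    using has_derivative_add [OF x_deriv] by fastforce
  have "((\<lambda>s. h (?x s + Z s *s w)) has_derivative (\<lambda>s. h' (s *\<^sub>R v))) (at 0)"
    using has_derivative_compose [OF g_deriv, of h h'] dh Z0 by simp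
  moreover have "\<forall>\<^sub>F s in at 0. h (?x s + Z s *s w) = 0"
  proof -
    have "((\<lambda>s. ?x s + Z s *s w) \<longlongrightarrow> p) (at 0)"
      using has_derivative_continuous [OF g_deriv] Z0 by (simp add: continuous_within)
    then have "\<forall>\<^sub>F s in at 0. ?x s + Z s *s w \<in> U" using U by (rule topological_tendstoD)
    with ev_m show ?thesis
    proof eventually_elim
      case (elim s)
      then have "differential F (?x s) w \<noteq> 0" using \<open>m > 0\<close> by auto
      with elim Z h show ?case by blast
    qed
  qed
  ultimately have "((\<lambda>s :: real. 0 :: complex) has_derivative (\<lambda>s. h' (s *\<^sub>R v))) (at 0)"
    by (rule has_derivative_transform_eventually) (use Z0 h U p in auto)
  then have "(\<lambda>s. h' (s *\<^sub>R v)) = (\<lambda>s. 0)"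
    by (rule has_derivative_unique) simp
  then show ?thesis by (metis scaleR_one)
qed

lemma separated_finite_set:
  fixes Z :: "complex set"
  assumes "finite Z"
  obtains e where "e > 0" "\<And>x y. x \<in> Z \<Longrightarrow> y \<in> Z \<Longrightarrow> x \<noteq> y \<Longrightarrow> 2 * e \<le> dist x y"
proof -
  define D where "D = (\<lambda>(x, y). dist x y) ` {(x, y). x \<in> Z \<and> y \<in> Z \<and> x \<noteq> y}"
  have "finite {(x, y). x \<in> Z \<and> y \<in> Z \<and> x \<noteq> y}"
    by (rule finite_subset [of _ "Z \<times> Z"]) (use assms in auto)
  then have fin: "finite (insert 1 D)" by (simp add: D_def)
  show thesis
  proof (rule that [of "Min (insert 1 D) / 2"])
    show "0 < Min (insert 1 D) / 2" using fin by (auto simp: D_def)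
    fix x y assume "x \<in> Z" "y \<in> Z" "x \<noteq> y"
    then have "dist x y \<in> D" by (force simp: D_def)
    then have "Min (insert 1 D) \<le> dist x y" using fin by (intro Min_le) auto
    then show "2 * (Min (insert 1 D) / 2) \<le> dist x y" by simp
  qed
qed

text \<open>Zeros of \<open>f\<close> on a line in a non-asymptotic direction \<open>c\<close> move continuously with the line, so zeros at which
\<open>g\<close> does not vanish persist.\<close>

lemma roots_on_line_persist:
  fixes f g :: "complex^4 \<Rightarrow> complex"
  assumes f: "hompoly d f" "f c \<noteq> 0" "continuous_on UNIV f" and g: "continuous_on UNIV g"
    and z0: "f (a0 + z0 *s c) = 0" "g (a0 + z0 *s c) \<noteq> 0" and "e > 0"
  shows "\<forall>\<^sub>F a in nhds a0. \<exists>z. dist z z0 < e \<and> f (a + z *s c) = 0 \<and> g (a + z *s c) \<noteq> 0"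
proof -
  have "open {x. g x \<noteq> 0}" using g by (simp add: open_Collect_neq)
  then obtain r where r: "r > 0" "\<And>x. dist x (a0 + z0 *s c) < r \<Longrightarrow> g x \<noteq> 0"
    using z0(2) unfolding open_dist by auto
  obtain K where K: "K > 0" "\<And>z :: complex. norm (z *s c) \<le> norm z * K"
    using bounded_linear.pos_bounded [OF bounded_linear_vector_scalar [of c]] by blast
  define e' where "e' = min e (r / (2 * K))"
  have e': "e' > 0" "e' \<le> e" "e' * K \<le> r / 2"
    using \<open>e > 0\<close> r(1) K(1) by (auto simp: e'_def min_def field_simps)
  have "isCont (\<lambda>a. cmod (f (a + z0 *s c))) a0"
    by (intro continuous_norm continuous_on_imp_isCont_compose [OF f(3)] continuous_intros)
  then have "((\<lambda>a. cmod (f (a + z0 *s c))) \<longlongrightarrow> 0) (nhds a0)"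
    using tendsto_at_iff_tendsto_nhds [of "\<lambda>a. cmod (f (a + z0 *s c))" a0] z0 by (simp add: isCont_def)
  then have "\<forall>\<^sub>F a in nhds a0. cmod (f (a + z0 *s c)) < cmod (f c) * e' ^ d"
    by (rule order_tendstoD) (use f(2) e' in auto)
  moreover have "\<forall>\<^sub>F a in nhds a0. dist a a0 < r / 2"
    unfolding eventually_nhds_metric using r(1) by (intro exI [of _ "r / 2"]) auto
  ultimately show ?thesis
  proof eventually_elim
    case (elim a)
    obtain P where P: "degree P \<le> d" "coeff P d = f c" "\<And>z. f (a + z *s c) = poly P z"
      using hompoly_line [OF f(1)] by metis
    have "degree P = d" using P(1,2) f(2) le_degree [of P d] by simp
    then obtain z where z: "poly P z = 0" "cmod (z0 - z) < e'"
      using root_in_disc [of P d z0 e'] elim(1) P e' by auto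
    have "norm ((z - z0) *s c) \<le> cmod (z - z0) * K" by (rule K)
    also have "\<dots> \<le> e' * K" using z K(1) by (intro mult_right_mono) (auto simp: norm_minus_commute)
    finally have 1: "norm ((z - z0) *s c) \<le> r / 2" using e' by simp
    have "a + z *s c - (a0 + z0 *s c) = (a - a0) + (z - z0) *s c"
      by (simp add: vector_sub_rdistrib algebra_simps)
    then have "dist (a + z *s c) (a0 + z0 *s c) \<le> dist a a0 + norm ((z - z0) *s c)"
      by (metis dist_norm norm_triangle_ineq)
    with 1 elim(2) have "dist (a + z *s c) (a0 + z0 *s c) < r" by linarith
    then show ?case using r(2) z e' P(3)
      by (intro exI [of _ z]) (auto simp: dist_norm norm_minus_commute)
  qed
qed

text \<open>Among the lines in direction \<open>c\<close> that are considered, choose one with the largest number of zeros of \<open>f\<close> at which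
\<open>g\<close> is nonzero. If it also had a zero \<open>z1\<close> of \<open>f\<close> with \<open>g = 0\<close>, the parallel line
through a nearby zero of \<open>f\<close> with \<open>g \<noteq> 0\<close> would keep all these zeros and gain one more.\<close>

lemma line_without_common_zero:
  fixes f g :: "complex^4 \<Rightarrow> complex"
  assumes f: "hompoly d f" "f c \<noteq> 0" "continuous_on UNIV f" and g: "continuous_on UNIV g"
    and A: "open A" "A \<noteq> {}" "\<And>a z. a \<in> A \<Longrightarrow> a + z *s c \<in> A"
    and dense: "\<And>p e. p \<in> A \<Longrightarrow> f p = 0 \<Longrightarrow> e > 0 \<Longrightarrow> \<exists>q. dist q p < e \<and> f q = 0 \<and> g q \<noteq> 0"
  shows "\<exists>a\<in>A. \<forall>z. \<not> (f (a + z *s c) = 0 \<and> g (a + z *s c) = 0)"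
proof -
  define good where "good a = {z. f (a + z *s c) = 0 \<and> g (a + z *s c) \<noteq> 0}" for a
  have fin: "finite (good a) \<and> card (good a) \<le> d" for a
  proof -
    obtain P where P: "degree P \<le> d" "coeff P d = f c" "\<And>z. f (a + z *s c) = poly P z"
      using hompoly_line [OF f(1)] by metis
    have "P \<noteq> 0" using P(2) f(2) by auto
    have "good a \<subseteq> {z. poly P z = 0}" using P(3) by (auto simp: good_def)
    moreover have "finite {z. poly P z = 0}" using \<open>P \<noteq> 0\<close> by (rule poly_roots_finite)
    moreover have "card {z. poly P z = 0} \<le> d" using card_poly_roots_bound [OF \<open>P \<noteq> 0\<close>] P(1) by linarith
    ultimately show ?thesis by (meson card_mono finite_subset order.trans)
  qed
  obtain b where "b \<in> A" using A(2) by blast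
  obtain a0 where a0: "a0 \<in> A" "\<And>a. a \<in> A \<Longrightarrow> card (good a) \<le> card (good a0)"
  proof -
    have "\<exists>a. a \<in> A \<and> (\<forall>y. y \<in> A \<longrightarrow> card (good y) \<le> card (good a))"
      using \<open>b \<in> A\<close> fin by (intro ex_has_greatest_nat [of _ b _ "Suc d"]) (auto simp: less_Suc_eq_le)
    then show thesis using that by blast
  qed
  have "\<not> (f (a0 + z1 *s c) = 0 \<and> g (a0 + z1 *s c) = 0)" for z1
  proof
    assume bad: "f (a0 + z1 *s c) = 0 \<and> g (a0 + z1 *s c) = 0"
    have z1: "z1 \<notin> good a0" using bad by (simp add: good_def)
    obtain e where e: "e > 0" "\<And>x y. x \<in> insert z1 (good a0) \<Longrightarrow> y \<in> insert z1 (good a0) \<Longrightarrow> x \<noteq> y \<Longrightarrow> 2 * e \<le> dist x y"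
      using separated_finite_set [of "insert z1 (good a0)"] fin by blast
    have "\<forall>\<^sub>F a in nhds a0. \<forall>z\<in>good a0. \<exists>y. dist y z < e \<and> f (a + y *s c) = 0 \<and> g (a + y *s c) \<noteq> 0"
      using fin e(1) by (intro eventually_ball_finite ballI roots_on_line_persist [OF f g]) (auto simp: good_def)
    moreover have "\<forall>\<^sub>F a in nhds a0. a \<in> A" using A(1) a0(1) by (rule eventually_nhds_in_open)
    ultimately have "\<forall>\<^sub>F a in nhds a0. a \<in> A \<and> (\<forall>z\<in>good a0. \<exists>y. dist y z < e \<and> f (a + y *s c) = 0 \<and> g (a + y *s c) \<noteq> 0)"
      by eventually_elim blast
    then obtain r where r: "r > 0" "\<And>a. dist a a0 < r \<Longrightarrow> a \<in> A \<and> (\<forall>z\<in>good a0. \<exists>y. dist y z < e \<and> y \<in> good a)"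
      unfolding eventually_nhds_metric good_def by auto
    obtain q where q: "dist q (a0 + z1 *s c) < r" "f q = 0" "g q \<noteq> 0"
      using dense [OF A(3) [OF a0(1)]] bad r(1) by blast
    define a where "a = q - z1 *s c"
    have "dist a a0 < r" using q(1) by (simp add: a_def dist_norm algebra_simps)
    then have "a \<in> A" and near: "\<And>z. z \<in> good a0 \<Longrightarrow> \<exists>y. dist y z < e \<and> y \<in> good a" using r(2) by blast+
    have "z1 \<in> good a" using q by (simp add: a_def good_def)
    then have "\<forall>z\<in>insert z1 (good a0). \<exists>y. dist y z < e \<and> y \<in> good a"
      using near e(1) by (metis dist_self insertE)
    then obtain \<phi> where \<phi>: "\<And>z. z \<in> insert z1 (good a0) \<Longrightarrow> dist (\<phi> z) z < e \<and> \<phi> z \<in> good a" by metis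
    have "inj_on \<phi> (insert z1 (good a0))"
    proof (rule inj_onI, rule ccontr)
      fix x y assume xy: "x \<in> insert z1 (good a0)" "y \<in> insert z1 (good a0)" "\<phi> x = \<phi> y" "x \<noteq> y"
      have "dist x y \<le> dist (\<phi> x) x + dist (\<phi> x) y" by (rule dist_triangle3)
      also have "\<dots> < e + e" using \<phi> [OF xy(1)] \<phi> [OF xy(2)] xy(3) by (intro add_strict_mono) auto
      finally show False using e(2) [OF xy(1,2,4)] by simp
    qed
    then have "card (insert z1 (good a0)) \<le> card (good a)"
      using \<phi> fin by (intro card_inj_on_le [of \<phi>]) auto
    with a0(2) [OF \<open>a \<in> A\<close>] z1 fin show False by simp
  qed
  with a0(1) show ?thesis by blast
qed

text \<open>A line through a point where the first functions are nonzero and a point where the last one is nonzero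
contains only finitely many zeros of each of them.\<close>

lemma common_nonzero_point:
  assumes "finite \<Phi>" "\<And>f. f \<in> \<Phi> \<Longrightarrow> \<exists>d. hompoly d f" "\<And>f. f \<in> \<Phi> \<Longrightarrow> \<exists>x. f x \<noteq> 0"
  shows "\<exists>x. \<forall>f\<in>\<Phi>. f x \<noteq> 0"
  using assms
proof (induction \<Phi> rule: finite_induct)
  case (insert f \<Phi>)
  have "\<exists>x. \<forall>g\<in>\<Phi>. g x \<noteq> 0"
    by (rule insert.IH) (use insert.prems in \<open>simp_all\<close>)
  then obtain x where x: "\<And>g. g \<in> \<Phi> \<Longrightarrow> g x \<noteq> 0" by metis
  obtain y where y: "f y \<noteq> 0" using insert.prems(2) [of f] by auto
  have fin: "finite {z. g (x + z *s (y - x)) = 0}" if g: "g \<in> insert f \<Phi>" for g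
  proof -
    obtain d where "hompoly d g" using insert.prems(1) [OF g] by blast
    then obtain P where P: "\<And>z. g (x + z *s (y - x)) = poly P z" using hompoly_line by metis
    have "poly P 0 \<noteq> 0 \<or> poly P 1 \<noteq> 0" using g x y P [of 0] P [of 1] by auto
    then have "P \<noteq> 0" by auto
    then show ?thesis unfolding P by (rule poly_roots_finite)
  qed
  then have "finite (\<Union>g\<in>insert f \<Phi>. {z. g (x + z *s (y - x)) = 0})"
    by (intro finite_UN_I) (use insert.hyps(1) in simp_all)
  then obtain z where "z \<notin> (\<Union>g\<in>insert f \<Phi>. {z. g (x + z *s (y - x)) = 0})"
    using ex_new_if_finite [OF infinite_UNIV_char_0] by blast
  then show ?case by blast
qed simp

section \<open>Symplectic linear algebra\<close>

lemma span_four: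
  fixes e :: "4 \<Rightarrow> complex^4"
  assumes "\<And>c. (\<Sum>i\<in>UNIV. c i *s e i) = 0 \<Longrightarrow> \<forall>i. c i = 0"
  shows "\<exists>c. x = (\<Sum>i\<in>UNIV. c i *s e i)"
proof -
  define A :: "complex^4^4" where "A = (\<chi> i j. e j $ i)"
  have col: "column i A = e i" for i by (simp add: A_def column_def)
  have "\<exists>B. B ** A = Finite_Cartesian_Product.mat 1"
    unfolding matrix_left_invertible_independent_columns col using assms by blast
  then obtain B where "A ** B = Finite_Cartesian_Product.mat 1" using matrix_left_right_inverse by blast
  then have "x = A *v (B *v x)" by (simp add: matrix_vector_mul_assoc)
  also have "\<dots> = (\<Sum>i\<in>UNIV. (B *v x) $ i *s e i)" by (simp add: matrix_mult_sum col)
  finally show ?thesis by blast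
qed

definition independent_pair :: "complex^4 \<Rightarrow> complex^4 \<Rightarrow> bool" where
  "independent_pair p q \<longleftrightarrow> (\<forall>\<alpha> \<beta>. \<alpha> *s p + \<beta> *s q = 0 \<longrightarrow> \<alpha> = 0 \<and> \<beta> = 0)"

text \<open>The span of two vectors, in the form in which its elements are used: with explicit coefficients.\<close>

definition plane_of :: "complex^4 \<Rightarrow> complex^4 \<Rightarrow> (complex^4) set" where
  "plane_of p q = {u. \<exists>\<alpha> \<beta>. u = \<alpha> *s p + \<beta> *s q}"

lemma plane_of_altdef: "plane_of p q = vec.span {p, q}"
proof -
  have "x \<in> vec.span {p, q} \<longleftrightarrow> (\<exists>k. x - k *s p \<in> vec.span {q})" for x
    by (rule vec.span_breakdown_eq)
  also have "\<dots> x \<longleftrightarrow> (\<exists>k l. x - k *s p - l *s q = 0)" for x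
    unfolding vec.span_breakdown_eq [of _ q "{}"] by simp
  also have "\<dots> x \<longleftrightarrow> x \<in> plane_of p q" for x
    by (auto simp: plane_of_def algebra_simps)
  finally show ?thesis by auto
qed

lemma in_plane_of: "p \<in> plane_of p q" "q \<in> plane_of p q"
  by (auto simp: plane_of_altdef intro: vec.span_base)

lemma independent_pair_if_minor_nonzero:
  assumes "q $ i * p $ j - q $ j * p $ i \<noteq> 0"
  shows "independent_pair p q"
  unfolding independent_pair_def
proof (intro allI impI)
  fix \<alpha> \<beta> assume *: "\<alpha> *s p + \<beta> *s q = 0"
  have eq: "\<alpha> * p $ k + \<beta> * q $ k = 0" for k
    using arg_cong [OF *, of "\<lambda>v. v $ k"] by simp
  have "\<alpha> * (q $ i * p $ j - q $ j * p $ i) = q $ i * (\<alpha> * p $ j + \<beta> * q $ j) - q $ j * (\<alpha> * p $ i + \<beta> * q $ i)"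
    "\<beta> * (q $ i * p $ j - q $ j * p $ i) = p $ j * (\<alpha> * p $ i + \<beta> * q $ i) - p $ i * (\<alpha> * p $ j + \<beta> * q $ j)"
    by (simp_all add: algebra_simps)
  then have "\<alpha> * (q $ i * p $ j - q $ j * p $ i) = 0" "\<beta> * (q $ i * p $ j - q $ j * p $ i) = 0"
    by (simp_all only: eq mult_zero_right diff_zero)
  with assms show "\<alpha> = 0 \<and> \<beta> = 0" by (simp only: mult_eq_0_iff) simp
qed

lemma parallel_if_minors_vanish:
  fixes p u :: "complex^4"
  assumes "p \<noteq> 0" "\<And>i j. u $ i * p $ j = u $ j * p $ i"
  obtains e where "u = e *s p"
proof -
  obtain j where "p $ j \<noteq> 0" using assms(1) by (auto simp: Finite_Cartesian_Product.vec_eq_iff)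
  then have "u = (u $ j / p $ j) *s p"
    using assms(2) by (simp add: Finite_Cartesian_Product.vec_eq_iff field_simps)
  then show thesis by (rule that)
qed

lemma exists_outside_plane: "\<exists>x :: complex^4. x \<notin> plane_of p q"
proof (rule ccontr)
  assume "\<not> ?thesis"
  then have "(UNIV :: (complex^4) set) \<subseteq> vec.span {p, q}" by (auto simp: plane_of_altdef)
  then have "vec.dim (UNIV :: (complex^4) set) \<le> card {p, q}" by (rule vec.dim_le_card) simp
  moreover have "card {p, q} \<le> 2" by (simp add: card_insert_if)
  moreover have "vec.dim (UNIV :: (complex^4) set) = 4" by (simp add: vec_dim_card card_cart_basis)
  ultimately show False by simp
qed

lemma is_plane_iff: "is_plane W \<longleftrightarrow> (\<exists>p q. independent_pair p q \<and> W = plane_of p q)"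
proof
  assume "is_plane W"
  then have W: "vec.subspace W" "vec.dim W = 2" by (auto simp: is_plane_def)
  obtain B where B: "B \<subseteq> W" "vec.independent B" "W \<subseteq> vec.span B" "card B = 2"
    using vec.basis_exists [of W] W(2) by metis
  then obtain p q where pq: "B = {p, q}" "p \<noteq> q" by (auto simp: card_2_iff)
  have "W = vec.span B" using B W(1) by (simp add: subset_antisym vec.span_minimal)
  moreover have "independent_pair p q"
    unfolding independent_pair_def
  proof (intro allI impI)
    fix \<alpha> \<beta> assume *: "\<alpha> *s p + \<beta> *s q = 0"
    let ?c = "\<lambda>v. if v = p then \<alpha> else \<beta>"
    have "(\<Sum>v\<in>B. ?c v *s v) = 0" using * pq by simp
    then have "?c v = 0" if "v \<in> B" for v
      using vec.independentD [OF B(2), of B ?c v] that pq(1) by auto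
    from this [of p] this [of q] show "\<alpha> = 0 \<and> \<beta> = 0" using pq by auto
  qed
  ultimately show "\<exists>p q. independent_pair p q \<and> W = plane_of p q" using pq plane_of_altdef by blast
next
  assume "\<exists>p q. independent_pair p q \<and> W = plane_of p q"
  then obtain p q where pq: "independent_pair p q" "W = plane_of p q" by blast
  have "p \<noteq> q"
  proof
    assume "p = q"
    then have "1 *s p + (-1) *s q = 0" by (simp add: Finite_Cartesian_Product.vec_eq_iff)
    with pq(1) have "(1::complex) = 0" unfolding independent_pair_def by blast
    then show False by simp
  qed
  have "q \<notin> vec.span {}" using pq(1) unfolding independent_pair_def
    by (metis add.left_neutral vector_smult_lzero vector_smult_rzero vec.span_empty singletonD zero_neq_one)
  moreover have "p \<notin> vec.span {q}"
  proof
    assume "p \<in> vec.span {q}"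
    then obtain k where "p - k *s q = 0" unfolding vec.span_breakdown_eq [of _ q "{}"] by auto
    then have "1 *s p + (- k) *s q = 0" by (simp add: Finite_Cartesian_Product.vec_eq_iff)
    with pq(1) have "(1::complex) = 0" unfolding independent_pair_def by blast
    then show False by simp
  qed
  ultimately have "vec.independent {p, q}"
    using \<open>p \<noteq> q\<close> by (simp add: vec.independent_insert)
  then have "vec.dim (vec.span {p, q}) = card {p, q}" by (rule vec.dim_span_eq_card_independent)
  with \<open>p \<noteq> q\<close> pq(2) show "is_plane W"
    by (simp add: is_plane_def plane_of_altdef vec.subspace_span)
qed

lemma radial_eq: "radial x = x"
  by (simp add: radial_def Finite_Cartesian_Product.vec_eq_iff axis_def if_distrib sum.delta cong: if_cong)

lemma projectivization_subset_zero_locus_iff: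
  assumes "homogeneous4 d F" "0 < d" "vec.subspace W"
  shows "projectivization W \<subseteq> zero_locus F \<longleftrightarrow> (\<forall>x\<in>W. eval4 F x = 0)"
proof
  assume sub: "projectivization W \<subseteq> zero_locus F"
  show "\<forall>x\<in>W. eval4 F x = 0"
  proof
    fix x assume "x \<in> W"
    show "eval4 F x = 0"
    proof (cases "x = 0")
      case True
      then show ?thesis using eval4_scale [OF assms(1), of 0 x] assms(2) by (simp add: zero_power)
    next
      case False
      then have "vec.dim (vec.span {x}) = 1"
        using vec.dim_span_eq_card_independent [of "{x}"] by (simp add: vec.independent_insert)
      then have "vec.span {x} \<in> projectivization W"
        using \<open>x \<in> W\<close> assms(3) by (simp add: projectivization_def proj_space_def vec.subspace_span vec.span_minimal)
      with sub show ?thesis by (auto simp: zero_locus_def intro: vec.span_base)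
    qed
  qed
qed (auto simp: projectivization_def zero_locus_def)

text \<open>The plane is recovered from its projectivization, so distinct planes define distinct lines.\<close>

lemma union_projectivization:
  assumes "vec.subspace W"
  shows "insert 0 (\<Union> (projectivization W)) = W"
proof
  show "insert 0 (\<Union> (projectivization W)) \<subseteq> W"
    using assms by (auto simp: projectivization_def vec.subspace_0)
  show "W \<subseteq> insert 0 (\<Union> (projectivization W))"
  proof
    fix x assume "x \<in> W"
    show "x \<in> insert 0 (\<Union> (projectivization W))"
    proof (cases "x = 0")
      case False
      then have "vec.dim (vec.span {x}) = 1"
        using vec.dim_span_eq_card_independent [of "{x}"] by (simp add: vec.independent_insert)
      then have "vec.span {x} \<in> projectivization W"
        using \<open>x \<in> W\<close> assms by (simp add: projectivization_def proj_space_def vec.subspace_span vec.span_minimal)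
      moreover have "x \<in> vec.span {x}" by (simp add: vec.span_base)
      ultimately show ?thesis by blast
    qed simp
  qed
qed

locale symplectic_space =
  fixes \<sigma> :: "complex^4 \<Rightarrow> complex^4 \<Rightarrow> complex"
  assumes symplectic: "symplectic \<sigma>"
begin

lemma two_form_coefficients: obtains lam where "\<sigma> = two_form lam"
  using symplectic by (auto simp: symplectic_def)

lemma add_left: "\<sigma> (u + v) w = \<sigma> u w + \<sigma> v w"
proof -
  obtain lam where lam: "\<sigma> = two_form lam" by (rule two_form_coefficients)
  show ?thesis unfolding lam two_form_def sum.distrib [symmetric]
    by (intro sum.cong refl) (simp add: algebra_simps)
qed

lemma add_right: "\<sigma> u (v + w) = \<sigma> u v + \<sigma> u w"
proof -
  obtain lam where lam: "\<sigma> = two_form lam" by (rule two_form_coefficients)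
  show ?thesis unfolding lam two_form_def sum.distrib [symmetric]
    by (intro sum.cong refl) (simp add: algebra_simps)
qed

lemma scale_left: "\<sigma> (c *s u) v = c * \<sigma> u v"
  by (rule two_form_coefficients) (simp add: two_form_def algebra_simps sum_distrib_left)

lemma scale_right: "\<sigma> u (c *s v) = c * \<sigma> u v"
  by (rule two_form_coefficients) (simp add: two_form_def algebra_simps sum_distrib_left)

lemma self: "\<sigma> u u = 0"
  by (rule two_form_coefficients) (simp add: two_form_def algebra_simps)

lemma swap: "\<sigma> u v = - \<sigma> v u"
proof -
  have "\<sigma> (u + v) (u + v) = \<sigma> u v + \<sigma> v u"
    by (simp only: add_left add_right self [of u] self [of v]) simp
  then have "\<sigma> u v + \<sigma> v u = 0" by (simp only: self)
  then show ?thesis by (simp add: add_eq_0_iff2)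
qed

lemma nondegenerate: "(\<And>v. \<sigma> u v = 0) \<Longrightarrow> u = 0"
  using symplectic by (auto simp: symplectic_def)

lemma zero [simp]: "\<sigma> 0 v = 0" "\<sigma> v 0 = 0"
  using scale_left [of 0 0 v] scale_right [of v 0 0] by simp_all

lemma minus_left: "\<sigma> (- u) v = - \<sigma> u v"
  using scale_left [of "-1" u v] by simp

lemma minus_right: "\<sigma> v (- u) = - \<sigma> v u"
  using scale_right [of v "-1" u] by simp

lemma diff_left: "\<sigma> (u - v) w = \<sigma> u w - \<sigma> v w"
  using add_left [of u "- v" w] by (simp add: minus_left)

lemma diff_right: "\<sigma> w (u - v) = \<sigma> w u - \<sigma> w v"
  using add_right [of w u "- v"] by (simp add: minus_right)

lemmas bilinear = add_left add_right scale_left scale_right diff_left diff_right minus_left minus_right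

lemma hompoly_sigma: "hompoly 1 (\<sigma> u)"
proof -
  obtain lam where lam: "\<sigma> = two_form lam" by (rule two_form_coefficients)
  have "\<sigma> u = (\<lambda>v. \<Sum>i\<in>UNIV. \<Sum>j\<in>UNIV. (lam $ i $ j * u $ i) * v $ j + (- lam $ i $ j * u $ j) * v $ i)"
    by (simp add: lam two_form_def fun_eq_iff algebra_simps)
  then show ?thesis
    by (simp only:) (intro hompoly_sum hompoly_add hompoly_cmult hompoly_nth)
qed

lemma continuous_sigma: "continuous_on S (\<sigma> u)"
proof -
  obtain lam where lam: "\<sigma> = two_form lam" by (rule two_form_coefficients)
  show ?thesis unfolding lam two_form_def by (intro continuous_intros)
qed

text \<open>Nondegeneracy makes \<open>u \<mapsto> \<sigma> u\<close> an isomorphism onto the dual space. Its inverse turns differentials into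
Hamiltonian vectors.\<close>

lemma exists_dual_matrix: "\<exists>N. \<forall>g v. \<sigma> (N *v g) v = (\<Sum>i\<in>UNIV. v $ i * g $ i)"
proof -
  obtain lam where lam: "\<sigma> = two_form lam" by (rule two_form_coefficients)
  define M :: "complex^4^4" where "M = (\<chi> j i. lam $ i $ j - lam $ j $ i)"
  have \<sigma>: "\<sigma> u v = (\<Sum>j\<in>UNIV. v $ j * (M *v u) $ j)" for u v
  proof -
    have "\<sigma> u v = (\<Sum>i\<in>UNIV. \<Sum>j\<in>UNIV. lam $ i $ j * u $ i * v $ j) - (\<Sum>i\<in>UNIV. \<Sum>j\<in>UNIV. lam $ i $ j * u $ j * v $ i)"
      by (simp add: lam two_form_def algebra_simps sum_subtractf)
    also have "(\<Sum>i\<in>UNIV. \<Sum>j\<in>UNIV. lam $ i $ j * u $ i * v $ j) = (\<Sum>j\<in>UNIV. \<Sum>i\<in>UNIV. lam $ i $ j * u $ i * v $ j)"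
      by (rule sum.swap)
    finally show ?thesis
      by (simp add: M_def matrix_vector_mult_def sum_distrib_left sum_subtractf algebra_simps)
  qed
  have "M *v u = 0 \<longrightarrow> u = 0" for u
    using nondegenerate [of u] \<sigma> [of u] by simp
  then obtain B where "B ** M = Finite_Cartesian_Product.mat 1"
    using matrix_left_invertible_ker [of M] by blast
  then have "M ** B = Finite_Cartesian_Product.mat 1" using matrix_left_right_inverse by blast
  then have "M *v (B *v g) = g" for g by (simp add: matrix_vector_mul_assoc)
  then show ?thesis using \<sigma> by metis
qed

definition dual_matrix :: "complex^4^4" where
  "dual_matrix = (SOME N. \<forall>g v. \<sigma> (N *v g) v = (\<Sum>i\<in>UNIV. v $ i * g $ i))"

lemma sigma_dual_matrix: "\<sigma> (dual_matrix *v g) v = (\<Sum>i\<in>UNIV. v $ i * g $ i)"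
  using someI_ex [OF exists_dual_matrix] unfolding dual_matrix_def by blast

text \<open>The functionals \<open>\<sigma> p\<close> and \<open>\<sigma> q\<close> are linearly independent, so some vector separates them.\<close>

lemma dual_vector:
  assumes "independent_pair p q"
  obtains e where "\<sigma> p e = 1" "\<sigma> q e = 0"
proof -
  have "\<exists>x. \<sigma> q x = 0 \<and> \<sigma> p x \<noteq> 0"
  proof (rule ccontr)
    assume none: "\<not> ?thesis"
    have "q \<noteq> 0"
    proof
      assume "q = 0"
      then have "0 *s p + 1 *s q = 0" by simp
      with assms have "(1 :: complex) = 0" unfolding independent_pair_def by blast
      then show False by simp
    qed
    then obtain y where y: "\<sigma> q y \<noteq> 0" using nondegenerate by blast
    have "\<sigma> (\<sigma> q y *s p + (- \<sigma> p y) *s q) x = 0" for x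
    proof -
      have "\<sigma> q (\<sigma> q y *s x - \<sigma> q x *s y) = 0" by (simp add: bilinear)
      then have "\<sigma> p (\<sigma> q y *s x - \<sigma> q x *s y) = 0" using none by blast
      then show ?thesis by (simp add: bilinear algebra_simps)
    qed
    then have "\<sigma> q y *s p + (- \<sigma> p y) *s q = 0" by (rule nondegenerate)
    with assms y show False unfolding independent_pair_def by blast
  qed
  then obtain x where "\<sigma> q x = 0" "\<sigma> p x \<noteq> 0" by blast
  then show thesis by (intro that [of "(1 / \<sigma> p x) *s x"]) (simp_all add: scale_right)
qed

lemma independent_pair_swap: "independent_pair p q \<Longrightarrow> independent_pair q p"
  unfolding independent_pair_def by (metis add.commute)

lemma independent_pair_nonzero: "independent_pair p q \<Longrightarrow> p \<noteq> 0 \<and> q \<noteq> 0"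
  by (metis dual_vector independent_pair_swap zero(1) zero_neq_one)

text \<open>Dual vectors \<open>e\<close> and \<open>f\<close> complete \<open>p\<close> and \<open>q\<close> to a basis. Pairing with \<open>p\<close> and \<open>q\<close> reads off the
coefficients of \<open>e\<close> and \<open>f\<close>, and these vanish for \<open>u\<close>.\<close>

lemma lagrangian_plane_maximal:
  assumes pq: "independent_pair p q" "\<sigma> p q = 0" and u: "\<sigma> p u = 0" "\<sigma> q u = 0"
  shows "u \<in> plane_of p q"
proof -
  obtain e where e: "\<sigma> p e = 1" "\<sigma> q e = 0" using dual_vector [OF pq(1)] .
  obtain f where f: "\<sigma> q f = 1" "\<sigma> p f = 0" using dual_vector [OF independent_pair_swap [OF pq(1)]] .
  have qp: "\<sigma> q p = 0" using pq(2) swap [of q p] by simp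
  define b :: "4 \<Rightarrow> complex^4" where "b i = (if i = 1 then p else if i = 2 then q else if i = 3 then e else f)" for i
  have sum_b: "(\<Sum>i\<in>UNIV. c i *s b i) = c 1 *s p + c 2 *s q + c 3 *s e + c 4 *s f" for c
    by (simp add: sum_4 b_def)
  have coords: "c 3 = 0 \<and> c 4 = 0" if "\<sigma> p (\<Sum>i\<in>UNIV. c i *s b i) = 0" "\<sigma> q (\<Sum>i\<in>UNIV. c i *s b i) = 0" for c
    using that unfolding sum_b by (simp add: bilinear e f self pq(2) qp)
  have "\<forall>i. c i = 0" if "(\<Sum>i\<in>UNIV. c i *s b i) = 0" for c
  proof -
    have "c 3 = 0 \<and> c 4 = 0" using coords that by simp
    with that pq(1) have "c 1 = 0 \<and> c 2 = 0" unfolding sum_b independent_pair_def by simp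
    with \<open>c 3 = 0 \<and> c 4 = 0\<close> show ?thesis by (simp add: forall_4)
  qed
  then obtain c where c: "u = (\<Sum>i\<in>UNIV. c i *s b i)" using span_four by blast
  with u coords have "c 3 = 0 \<and> c 4 = 0" by simp
  then show ?thesis using c unfolding sum_b plane_of_def by auto
qed

lemma plane_of_orthogonal:
  assumes "independent_pair p q" "\<sigma> p q = 0"
  shows "plane_of p q = {u. \<sigma> p u = 0 \<and> \<sigma> q u = 0}"
proof -
  have "\<sigma> q p = 0" using assms(2) swap [of q p] by simp
  then show ?thesis using lagrangian_plane_maximal [OF assms] assms(2)
    by (auto simp: plane_of_def bilinear self)
qed

text \<open>The orthogonal hyperplane of \<open>q\<close> has dimension three and isotropic subspaces have dimension at most two.\<close>

lemma hyperplane_not_isotropic: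
  assumes "q \<noteq> 0"
  obtains v w where "\<sigma> q v = 0" "\<sigma> q w = 0" "\<sigma> v w \<noteq> 0"
proof -
  obtain y where y: "\<sigma> q y \<noteq> 0" using assms nondegenerate by blast
  obtain x where x: "x \<notin> plane_of q y" using exists_outside_plane by blast
  define v where "v = x - (\<sigma> q x / \<sigma> q y) *s y"
  have v: "\<sigma> q v = 0" using y by (simp add: v_def bilinear)
  have "independent_pair v q"
    unfolding independent_pair_def
  proof (intro allI impI)
    fix \<alpha> \<beta> assume *: "\<alpha> *s v + \<beta> *s q = 0"
    have "\<alpha> = 0"
    proof (rule ccontr)
      assume "\<alpha> \<noteq> 0"
      then have "x = (- \<beta> / \<alpha>) *s q + (\<sigma> q x / \<sigma> q y) *s y"
        using * by (simp add: v_def Finite_Cartesian_Product.vec_eq_iff field_simps)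
      with x show False unfolding plane_of_def by blast
    qed
    with * assms show "\<alpha> = 0 \<and> \<beta> = 0" by simp
  qed
  then obtain w where "\<sigma> v w = 1" "\<sigma> q w = 0" by (rule dual_vector)
  with v show thesis by (intro that [of v w]) auto
qed

definition lagrangian :: "(complex^4) set \<Rightarrow> bool" where
  "lagrangian W \<longleftrightarrow> is_plane W \<and> (\<forall>x\<in>W. \<forall>y\<in>W. \<sigma> x y = 0)"

lemma involutive_line_iff: "involutive_line \<sigma> L \<longleftrightarrow> (\<exists>W. lagrangian W \<and> L = projectivization W)"
  by (auto simp: involutive_line_def lagrangian_def contact_form_def radial_eq)

lemma lagrangian_orthogonal:
  assumes W: "lagrangian W" and xy: "x \<in> W" "y \<in> W" "independent_pair x y"
  shows "W = {u. \<sigma> x u = 0 \<and> \<sigma> y u = 0}"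
proof
  show "W \<subseteq> {u. \<sigma> x u = 0 \<and> \<sigma> y u = 0}" using W xy by (auto simp: lagrangian_def)
  have "plane_of x y \<subseteq> W"
    using W xy unfolding lagrangian_def is_plane_def plane_of_altdef by (intro vec.span_minimal) auto
  then show "{u. \<sigma> x u = 0 \<and> \<sigma> y u = 0} \<subseteq> W"
    using lagrangian_plane_maximal [OF xy(3)] W xy by (auto simp: lagrangian_def)
qed

lemma lagrangian_basis:
  assumes "lagrangian W"
  obtains p q where "independent_pair p q" "W = plane_of p q" "\<sigma> p q = 0" "p \<in> W" "q \<in> W"
proof -
  obtain p q where "independent_pair p q" "W = plane_of p q"
    using assms is_plane_iff by (auto simp: lagrangian_def)
  with assms in_plane_of [of p q] in_plane_of [of q p] show thesis
    by (intro that [of p q]) (auto simp: lagrangian_def)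
qed

text \<open>Two independent vectors in common would span both planes, so distinct Lagrangian planes meet in at most a line.\<close>

lemma lagrangian_intersection:
  assumes W: "lagrangian W" "lagrangian W'" "W \<noteq> W'"
  shows "\<exists>r. r \<noteq> 0 \<and> (\<forall>x\<in>W \<inter> W'. \<exists>k. x = k *s r)"
proof (cases "\<exists>r\<in>W \<inter> W'. r \<noteq> 0")
  case True
  then obtain r where r: "r \<in> W \<inter> W'" "r \<noteq> 0" by blast
  have "\<exists>k. x = k *s r" if "x \<in> W \<inter> W'" for x
  proof (rule ccontr)
    assume no: "\<not> ?thesis"
    have "independent_pair x r"
      unfolding independent_pair_def
    proof (intro allI impI)
      fix \<alpha> \<beta> assume *: "\<alpha> *s x + \<beta> *s r = 0"
      have "\<alpha> = 0"
      proof (rule ccontr)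
        assume "\<alpha> \<noteq> 0"
        have "x = (1 / \<alpha>) *s (\<alpha> *s x)" using \<open>\<alpha> \<noteq> 0\<close> by (simp add: vector_smult_assoc)
        also have "\<alpha> *s x = - (\<beta> *s r)" using * by (simp add: eq_neg_iff_add_eq_0)
        also have "(1 / \<alpha>) *s (- (\<beta> *s r)) = (- \<beta> / \<alpha>) *s r"
          by (simp add: Finite_Cartesian_Product.vec_eq_iff)
        finally show False using no by blast
      qed
      with * r(2) show "\<alpha> = 0 \<and> \<beta> = 0" by simp
    qed
    then have "W = W'"
      using lagrangian_orthogonal [OF W(1), of x r] lagrangian_orthogonal [OF W(2), of x r] that r by auto
    with W(3) show False by simp
  qed
  with r show ?thesis by blast
next
  case False
  obtain p q where "independent_pair p q" using lagrangian_basis [OF W(1)] by metis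
  then have "p \<noteq> 0" using independent_pair_nonzero by blast
  with False show ?thesis by (metis vector_smult_lzero)
qed

end

section \<open>The Hamiltonian vector field of a form\<close>

text \<open>The \<open>k\<close>-th derivative of \<open>F\<close> at \<open>p\<close>, evaluated on \<open>k\<close> copies of \<open>q\<close>.\<close>

primrec jet :: "nat \<Rightarrow> poly4 \<Rightarrow> complex^4 \<Rightarrow> complex^4 \<Rightarrow> complex" where
  "jet 0 F p q = eval4 F p"
| "jet (Suc k) F p q = (\<Sum>i\<in>UNIV. q $ i * jet k (partial4 i F) p q)"

text \<open>Both the base point and the direction move. Since \<open>jet k\<close> is a symmetric \<open>k\<close>-linear form on the diagonal, the
motion of the direction contributes \<open>k\<close> equal terms.\<close>

lemma has_derivative_jet:
  assumes "(X has_derivative X') (at x)"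
  shows "((\<lambda>x. jet k F x (X x)) has_derivative
    (\<lambda>v. (\<Sum>i\<in>UNIV. v $ i * jet k (partial4 i F) x (X x)) +
         of_nat k * (\<Sum>i\<in>UNIV. X' v $ i * jet (k - 1) (partial4 i F) x (X x)))) (at x)"
proof (induction k arbitrary: F)
  case 0
  then show ?case using has_derivative_eval4 [of F x] by simp
next
  case (Suc k)
  let ?q = "X x"
  have X_nth: "((\<lambda>x. X x $ i) has_derivative (\<lambda>v. X' v $ i)) (at x)" for i
    by (rule bounded_linear.has_derivative [OF bounded_linear_vec_nth assms])
  let ?D = "\<lambda>i v. (\<Sum>j\<in>UNIV. v $ j * jet k (partial4 j (partial4 i F)) x ?q) +
         of_nat k * (\<Sum>j\<in>UNIV. X' v $ j * jet (k - 1) (partial4 j (partial4 i F)) x ?q)"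
  have "((\<lambda>x. jet (Suc k) F x (X x)) has_derivative
     (\<lambda>v. \<Sum>i\<in>UNIV. ?q $ i * ?D i v + X' v $ i * jet k (partial4 i F) x ?q)) (at x)"
    unfolding jet.simps by (intro has_derivative_sum has_derivative_mult X_nth Suc.IH)
  moreover have "(\<Sum>i\<in>UNIV. ?q $ i * ?D i v + X' v $ i * jet k (partial4 i F) x ?q) =
      (\<Sum>i\<in>UNIV. v $ i * jet (Suc k) (partial4 i F) x ?q) +
         of_nat (Suc k) * (\<Sum>i\<in>UNIV. X' v $ i * jet (Suc k - 1) (partial4 i F) x ?q)" for v
  proof -
    have 1: "(\<Sum>i\<in>UNIV. ?q $ i * (\<Sum>j\<in>UNIV. v $ j * jet k (partial4 j (partial4 i F)) x ?q))
        = (\<Sum>i\<in>UNIV. v $ i * jet (Suc k) (partial4 i F) x ?q)"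
      unfolding jet.simps sum_distrib_left
      by (subst sum.swap) (simp add: partial4_commute mult_ac)
    have 2: "of_nat k * (\<Sum>i\<in>UNIV. ?q $ i * (\<Sum>j\<in>UNIV. X' v $ j * jet (k - 1) (partial4 j (partial4 i F)) x ?q))
        = of_nat k * (\<Sum>i\<in>UNIV. X' v $ i * jet k (partial4 i F) x ?q)"
    proof (cases k)
      case (Suc l)
      have "(\<Sum>i\<in>UNIV. ?q $ i * (\<Sum>j\<in>UNIV. X' v $ j * jet l (partial4 j (partial4 i F)) x ?q))
          = (\<Sum>i\<in>UNIV. X' v $ i * jet (Suc l) (partial4 i F) x ?q)"
        unfolding jet.simps sum_distrib_left
        by (subst sum.swap) (simp add: partial4_commute mult_ac)
      with Suc show ?thesis by simp
    qed simp
    have "(\<Sum>i\<in>UNIV. ?q $ i * ?D i v + X' v $ i * jet k (partial4 i F) x ?q)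
       = (\<Sum>i\<in>UNIV. ?q $ i * (\<Sum>j\<in>UNIV. v $ j * jet k (partial4 j (partial4 i F)) x ?q))
         + of_nat k * (\<Sum>i\<in>UNIV. ?q $ i * (\<Sum>j\<in>UNIV. X' v $ j * jet (k - 1) (partial4 j (partial4 i F)) x ?q))
         + (\<Sum>i\<in>UNIV. X' v $ i * jet k (partial4 i F) x ?q)"
      by (simp add: sum.distrib distrib_left sum_distrib_left [of "of_nat k" "\<lambda>i. ?q $ i * _ i"] mult.left_commute [of _ "of_nat k"])
    also have "\<dots> = (\<Sum>i\<in>UNIV. v $ i * jet (Suc k) (partial4 i F) x ?q)
        + of_nat k * (\<Sum>i\<in>UNIV. X' v $ i * jet k (partial4 i F) x ?q)
        + (\<Sum>i\<in>UNIV. X' v $ i * jet k (partial4 i F) x ?q)"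
      by (simp only: 1 2)
    finally show ?thesis by (simp add: distrib_right)
  qed
  ultimately show ?case by simp
qed

text \<open>Euler's identity for the derivatives of order \<open>k\<close>, which are forms of degree \<open>d - k\<close> in \<open>p\<close>.\<close>

lemma jet_Euler:
  assumes "homogeneous4 d F" "k \<le> d"
  shows "(\<Sum>i\<in>UNIV. p $ i * jet k (partial4 i F) p q) = of_nat (d - k) * jet k F p q"
  using assms
proof (induction k arbitrary: d F)
  case 0
  then show ?case using Euler_identity by simp
next
  case (Suc k)
  have "(\<Sum>i\<in>UNIV. p $ i * jet (Suc k) (partial4 i F) p q)
      = (\<Sum>j\<in>UNIV. q $ j * (\<Sum>i\<in>UNIV. p $ i * jet k (partial4 i (partial4 j F)) p q))"
    unfolding jet.simps sum_distrib_left
    by (subst sum.swap) (simp add: partial4_commute mult_ac)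
  also have "\<dots> = (\<Sum>j\<in>UNIV. q $ j * (of_nat (d - 1 - k) * jet k (partial4 j F) p q))"
    using Suc.IH [OF homogeneous4_partial4 [OF Suc.prems(1)]] Suc.prems(2) by simp
  also have "\<dots> = of_nat (d - Suc k) * jet (Suc k) F p q"
    by (simp add: sum_distrib_left mult_ac)
  finally show ?case .
qed

lemma jet_line:
  assumes "\<And>z. eval4 F (p + z *s q) = poly P z"
  shows "jet k F (p + z *s q) q = poly ((pderiv ^^ k) P) z"
proof (induction k arbitrary: z)
  case 0
  then show ?case using assms by simp
next
  case (Suc k)
  have line: "((\<lambda>z. p + z *s q) has_derivative (\<lambda>u. u *s q)) (at z)"
    by (auto intro!: derivative_eq_intros bounded_linear_imp_has_derivative bounded_linear_vector_scalar)
  have "((\<lambda>x. jet k F x q) has_derivative (\<lambda>v. \<Sum>i\<in>UNIV. v $ i * jet k (partial4 i F) (p + z *s q) q)) (at (p + z *s q))"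
    using has_derivative_jet [of "\<lambda>x. q" "\<lambda>v. 0" "p + z *s q" k F] by simp
  from has_derivative_compose [OF line this]
  have "((\<lambda>z. jet k F (p + z *s q) q) has_derivative (\<lambda>u. \<Sum>i\<in>UNIV. (u *s q) $ i * jet k (partial4 i F) (p + z *s q) q)) (at z)" .
  moreover have "(\<lambda>u. \<Sum>i\<in>UNIV. (u *s q) $ i * jet k (partial4 i F) (p + z *s q) q) = (\<lambda>u. jet (Suc k) F (p + z *s q) q * u)"
    by (simp add: fun_eq_iff sum_distrib_left mult_ac)
  ultimately have "(poly ((pderiv ^^ k) P) has_field_derivative jet (Suc k) F (p + z *s q) q) (at z)"
    unfolding has_field_derivative_def Suc.IH [abs_def] by simp
  then have "jet (Suc k) F (p + z *s q) q = poly (pderiv ((pderiv ^^ k) P)) z"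
    using DERIV_unique poly_DERIV by blast
  then show ?case by simp
qed

text \<open>Up to factorials the jets are the coefficients of the polynomial \<open>F(p + z q)\<close>, whose degree is at most \<open>d\<close>.\<close>

lemma line_in_surface_iff_jets_vanish:
  assumes "homogeneous4 d F"
  shows "(\<forall>z. eval4 F (p + z *s q) = 0) \<longleftrightarrow> (\<forall>k\<le>d. jet k F p q = 0)"
proof -
  obtain P where P: "degree P \<le> d" "\<And>z. eval4 F (p + z *s q) = poly P z"
    using hompoly_line [OF hompoly_eval4 [OF assms]] by metis
  have "jet k F p q = pochhammer 1 k * coeff P k" for k
    using jet_line [OF P(2), of k 0] by (simp add: poly_0_coeff_0 coeff_higher_pderiv)
  then have jet_coeff: "jet k F p q = fact k * coeff P k" for k by (simp add: pochhammer_fact)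
  have "(\<forall>z. eval4 F (p + z *s q) = 0) \<longleftrightarrow> P = 0"
    unfolding P(2) by (metis poly_0 poly_eq_poly_eq_iff ext)
  also have "\<dots> \<longleftrightarrow> (\<forall>k\<le>d. coeff P k = 0)"
    using P(1) by (metis coeff_0 leading_coeff_0_iff)
  also have "\<dots> \<longleftrightarrow> (\<forall>k\<le>d. jet k F p q = 0)" by (simp add: jet_coeff)
  finally show ?thesis .
qed

definition smooth_form :: "nat \<Rightarrow> poly4 \<Rightarrow> bool" where
  "smooth_form d F \<longleftrightarrow> homogeneous4 d F \<and>
     (\<forall>x. x \<noteq> 0 \<and> eval4 F x = 0 \<longrightarrow> (\<exists>i. eval4 (partial4 i F) x \<noteq> 0))"

lemma differential_axis: "differential F x (axis i 1) = eval4 (partial4 i F) x"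
  by (simp add: differential_def axis_def mult_delta_left)

lemma differential_radial: "homogeneous4 d F \<Longrightarrow> differential F x x = of_nat d * eval4 F x"
  by (simp add: differential_def Euler_identity)

lemma hompoly_differential:
  assumes "homogeneous4 d F"
  shows "hompoly (d - 1) (\<lambda>x. differential F x v)"
  unfolding differential_def by (intro hompoly_sum hompoly_cmult hompoly_eval4 homogeneous4_partial4 assms)

context symplectic_space
begin

definition hamiltonian :: "poly4 \<Rightarrow> complex^4 \<Rightarrow> complex^4" where
  "hamiltonian F x = dual_matrix *v (\<chi> i. eval4 (partial4 i F) x)"

text \<open>The derivative of the Hamiltonian field, the Hessian of \<open>F\<close> transported by \<open>\<sigma>\<close>.\<close>

definition d_hamiltonian :: "poly4 \<Rightarrow> complex^4 \<Rightarrow> complex^4 \<Rightarrow> complex^4" where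
  "d_hamiltonian F x v = dual_matrix *v (\<chi> i. differential (partial4 i F) x v)"

lemma sigma_hamiltonian: "\<sigma> (hamiltonian F x) v = differential F x v"
  by (simp add: hamiltonian_def sigma_dual_matrix differential_def)

lemma sigma_d_hamiltonian: "\<sigma> (d_hamiltonian F x v) w = (\<Sum>i\<in>UNIV. w $ i * differential (partial4 i F) x v)"
  by (simp add: d_hamiltonian_def sigma_dual_matrix)

lemma hessian_symmetric: "\<sigma> (d_hamiltonian F x v) w = \<sigma> (d_hamiltonian F x w) v"
  unfolding sigma_d_hamiltonian differential_def sum_distrib_left
  by (subst sum.swap) (simp add: partial4_commute mult_ac)

lemma d_hamiltonian_radial:
  assumes "homogeneous4 d F"
  shows "\<sigma> (d_hamiltonian F x x) w = of_nat (d - 1) * differential F x w"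
  unfolding sigma_d_hamiltonian differential_radial [OF homogeneous4_partial4 [OF assms]]
  by (simp add: differential_def sum_distrib_left mult_ac)

lemma jet_2_eq: "jet 2 F x q = \<sigma> (d_hamiltonian F x q) q"
  unfolding sigma_d_hamiltonian differential_def by (simp add: numeral_2_eq_2)

lemma hompoly_hamiltonian:
  assumes "homogeneous4 d F"
  shows "hompoly (d - 1) (\<lambda>x. hamiltonian F x $ i)"
  unfolding hamiltonian_def matrix_vector_mult_def vec_lambda_beta
  by (intro hompoly_sum hompoly_cmult hompoly_eval4 homogeneous4_partial4 assms)

lemma has_derivative_hamiltonian: "(hamiltonian F has_derivative d_hamiltonian F x) (at x)"
proof -
  have comp: "((\<lambda>y. hamiltonian F y $ i) has_derivative (\<lambda>v. d_hamiltonian F x v $ i)) (at x)" for i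
    unfolding hamiltonian_def d_hamiltonian_def matrix_vector_mult_def vec_lambda_beta
    by (intro has_derivative_sum has_derivative_mult_right has_derivative_eval4')
  have "((\<lambda>y. \<Sum>i\<in>UNIV. hamiltonian F y $ i *s axis i 1) has_derivative
      (\<lambda>v. \<Sum>i\<in>UNIV. d_hamiltonian F x v $ i *s axis i 1)) (at x)"
    by (intro has_derivative_sum bounded_linear.has_derivative [OF bounded_linear_vector_scalar comp])
  then show ?thesis by (simp add: basis_expansion)
qed

lemma continuous_hamiltonian: "continuous_on S (hamiltonian F)"
  by (meson has_derivative_hamiltonian has_derivative_at_withinI has_derivative_continuous continuous_on_eq_continuous_within)

lemma hamiltonian_nonzero:
  assumes "smooth_form d F" "x \<noteq> 0" "eval4 F x = 0"
  shows "hamiltonian F x \<noteq> 0"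
proof
  assume "hamiltonian F x = 0"
  then have "differential F x v = 0" for v using sigma_hamiltonian [of F x v] by simp
  with assms differential_axis show False unfolding smooth_form_def by metis
qed

lemma derivative_vanishes_on_surface:
  fixes h :: "complex^4 \<Rightarrow> complex"
  assumes F: "smooth_form d F" and U: "open U" "p \<in> U" and p: "p \<noteq> 0" "eval4 F p = 0"
    and v: "differential F p v = 0" and h: "\<And>x. x \<in> U \<Longrightarrow> eval4 F x = 0 \<Longrightarrow> h x = 0"
    and dh: "(h has_derivative h') (at p)"
  shows "h' v = 0"
proof -
  obtain i where "differential F p (axis i 1) \<noteq> 0"
    using F p unfolding smooth_form_def differential_axis by blast
  with F U p v h dh show ?thesis
    unfolding smooth_form_def by (intro derivative_vanishes_on_tangent_space [of d F U p v "axis i 1" h h']) auto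
qed

text \<open>The foliation that \<open>\<sigma>\<close> induces on the surface is singular where \<open>X\<close> is a multiple of \<open>x\<close>, that is, where the
tangent plane is the contact plane. If this held on an open set, then differentiating \<open>X(x) \<and> x = 0\<close> along tangent
vectors would identify the symmetric Hessian with a nonzero multiple of the alternating form \<open>\<sigma>\<close> on the tangent
space, and the tangent space would be isotropic.\<close>

lemma hamiltonian_not_radial_on_open_set:
  assumes F: "smooth_form d F" and U: "open U" "p \<in> U" and p: "p \<noteq> 0" "eval4 F p = 0"
  shows "\<exists>x\<in>U. eval4 F x = 0 \<and> (\<exists>i j. hamiltonian F x $ i * x $ j - hamiltonian F x $ j * x $ i \<noteq> 0)"
proof (rule ccontr)
  let ?X = "hamiltonian F" and ?X' = "d_hamiltonian F p"
  assume "\<not> ?thesis"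
  then have minors: "?X x $ i * x $ j - ?X x $ j * x $ i = 0" if "x \<in> U" "eval4 F x = 0" for x i j
    using that by blast
  have nz: "?X p \<noteq> 0" using hamiltonian_nonzero [OF F p] .
  obtain c where c: "?X p = c *s p"
    using parallel_if_minors_vanish [OF p(1), of "?X p"] minors [OF U(2) p(2)] by auto
  have "c \<noteq> 0" using nz c by auto
  have X'_tangent: "\<sigma> (?X' v) w = c * \<sigma> v w" if v: "differential F p v = 0" and w: "differential F p w = 0" for v w
  proof -
    have "?X' v $ i * p $ j + ?X p $ i * v $ j - (?X' v $ j * p $ i + ?X p $ j * v $ i) = 0" for i j
    proof (rule derivative_vanishes_on_surface [OF F U p v])
      show "((\<lambda>x. ?X x $ i * x $ j - ?X x $ j * x $ i) has_derivative
         (\<lambda>v. ?X' v $ i * p $ j + ?X p $ i * v $ j - (?X' v $ j * p $ i + ?X p $ j * v $ i))) (at p)"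
        by (rule derivative_eq_intros has_derivative_nth bounded_linear.has_derivative [OF bounded_linear_vec_nth has_derivative_hamiltonian] refl)+
          (simp add: fun_eq_iff algebra_simps)
    qed (rule minors)
    then have "(?X' v - c *s v) $ i * p $ j = (?X' v - c *s v) $ j * p $ i" for i j
      by (simp add: c algebra_simps)
    then obtain e where "?X' v - c *s v = e *s p" using parallel_if_minors_vanish [OF p(1)] by metis
    then have X'v: "?X' v = c *s v + e *s p" by (simp add: algebra_simps)
    have "c * \<sigma> p w = 0" using w sigma_hamiltonian [of F p w] by (simp add: c scale_left)
    with \<open>c \<noteq> 0\<close> show ?thesis by (simp add: X'v bilinear)
  qed
  obtain v w where vw: "\<sigma> (?X p) v = 0" "\<sigma> (?X p) w = 0" "\<sigma> v w \<noteq> 0"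
    using hyperplane_not_isotropic [OF nz] .
  have tangent: "differential F p v = 0" "differential F p w = 0" using vw by (simp_all add: sigma_hamiltonian)
  have "c * \<sigma> v w = \<sigma> (?X' v) w" by (simp only: X'_tangent tangent)
  also have "\<dots> = \<sigma> (?X' w) v" by (rule hessian_symmetric)
  also have "\<dots> = c * \<sigma> w v" by (simp only: X'_tangent tangent)
  finally have "c * \<sigma> v w = c * \<sigma> w v" .
  with \<open>c \<noteq> 0\<close> vw(3) swap [of v w] show False by simp
qed

text \<open>If the second derivative along \<open>X\<close> vanishes, then \<open>dX(X)\<close> is orthogonal to \<open>x\<close> and \<open>X\<close> and is therefore a
combination of them: the integral curves of \<open>X\<close> are lines. Differentiating \<open>jet (k+1)\<close> along \<open>X\<close> then gives
\<open>jet (k+2)\<close> plus multiples of \<open>jet (k+1)\<close> and, by Euler's identity, of \<open>jet k\<close>. So all jets vanish.\<close>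

lemma hamiltonian_lines_in_surface:
  assumes F: "smooth_form d F" and U: "open U"
    and ind: "\<And>x. x \<in> U \<Longrightarrow> independent_pair x (hamiltonian F x)"
    and G: "\<And>x. x \<in> U \<Longrightarrow> eval4 F x = 0 \<Longrightarrow> jet 2 F x (hamiltonian F x) = 0"
    and x: "x \<in> U" "eval4 F x = 0"
  shows "eval4 F (x + z *s hamiltonian F x) = 0"
proof -
  let ?X = "hamiltonian F" and ?X' = "d_hamiltonian F"
  have hom: "homogeneous4 d F" using F by (simp add: smooth_form_def)
  have tangent: "differential F x (?X x) = 0" for x using sigma_hamiltonian [of F x "?X x"] self by simp
  have X'X: "?X' x (?X x) \<in> plane_of x (?X x)" if "x \<in> U" "eval4 F x = 0" for x
  proof (rule lagrangian_plane_maximal)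
    show "independent_pair x (?X x)" using ind that by blast
    show "\<sigma> x (?X x) = 0"
      using swap [of x "?X x"] sigma_hamiltonian [of F x x] differential_radial [OF hom, of x] that by simp
    have "\<sigma> (?X' x (?X x)) x = 0"
      using hessian_symmetric [of F x "?X x" x] d_hamiltonian_radial [OF hom, of x "?X x"] tangent by simp
    then show "\<sigma> x (?X' x (?X x)) = 0" using swap [of x "?X' x (?X x)"] by simp
    show "\<sigma> (?X x) (?X' x (?X x)) = 0"
      using G [OF that] swap [of "?X x" "?X' x (?X x)"] by (simp add: jet_2_eq)
  qed
  have "\<forall>x\<in>U. eval4 F x = 0 \<longrightarrow> jet k F x (?X x) = 0" if "k \<le> d" for k
    using that
  proof (induction k rule: induct_nat_012)
    case 1
    then show ?case using tangent by (simp add: differential_def)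
  next
    case (ge2 k)
    show ?case
    proof (intro ballI impI)
      fix x assume x: "x \<in> U" "eval4 F x = 0"
      have IH: "jet k F x (?X x) = 0" "\<And>x. x \<in> U \<Longrightarrow> eval4 F x = 0 \<Longrightarrow> jet (Suc k) F x (?X x) = 0"
        using ge2 x by auto
      have "(\<Sum>i\<in>UNIV. ?X x $ i * jet (Suc k) (partial4 i F) x (?X x)) +
         of_nat (Suc k) * (\<Sum>i\<in>UNIV. ?X' x (?X x) $ i * jet (Suc k - 1) (partial4 i F) x (?X x)) = 0"
        by (rule derivative_vanishes_on_surface [OF F U x(1) _ x(2) tangent IH(2) has_derivative_jet [OF has_derivative_hamiltonian]])
           (use independent_pair_nonzero [OF ind [OF x(1)]] in auto)
      moreover obtain \<alpha> \<beta> where "?X' x (?X x) = \<alpha> *s x + \<beta> *s ?X x"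
        using X'X [OF x] unfolding plane_of_def by blast
      then have "(\<Sum>i\<in>UNIV. ?X' x (?X x) $ i * jet k (partial4 i F) x (?X x))
          = \<alpha> * (\<Sum>i\<in>UNIV. x $ i * jet k (partial4 i F) x (?X x)) + \<beta> * jet (Suc k) F x (?X x)"
        by (simp add: algebra_simps sum.distrib sum_distrib_left)
      moreover have "(\<Sum>i\<in>UNIV. x $ i * jet k (partial4 i F) x (?X x)) = 0"
        using jet_Euler [OF hom, of k x "?X x"] ge2.prems IH(1) by simp
      ultimately show "jet (Suc (Suc k)) F x (?X x) = 0"
        using IH(2) [OF x] by simp
    qed
  qed simp
  then show ?thesis using line_in_surface_iff_jets_vanish [OF hom, of x "?X x"] x by blast
qed

text \<open>The rigidity of lines in smooth surfaces of degree at least three. The lines \<open>y + z X(y)\<close> would lie in the surface for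
all \<open>y\<close> near \<open>x\<close>. Moving \<open>y\<close> in the tangent direction \<open>e\<close>, which is not orthogonal to \<open>x\<close> and hence not
in the plane of \<open>x\<close> and \<open>q\<close>, gives the relation \<open>A * L1 + B * L2 = 0\<close> with \<open>L1 \<noteq> 0\<close>. But \<open>A\<close> and \<open>B\<close>
are coprime, and one of them has degree \<open>d - 1 \<ge> 2\<close>.\<close>

lemma second_jet_not_zero_on_open_set:
  assumes F: "smooth_form d F" and d: "3 \<le> d" and U: "open U" "p \<in> U" and p: "p \<noteq> 0" "eval4 F p = 0"
  shows "\<exists>x\<in>U. eval4 F x = 0 \<and> jet 2 F x (hamiltonian F x) \<noteq> 0"
proof (rule ccontr)
  let ?X = "hamiltonian F" and ?X' = "d_hamiltonian F"
  assume "\<not> ?thesis"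
  then have G: "jet 2 F x (?X x) = 0" if "x \<in> U" "eval4 F x = 0" for x using that by blast
  have hom: "homogeneous4 d F" using F by (simp add: smooth_form_def)
  obtain x i j where x: "x \<in> U" "eval4 F x = 0" "?X x $ i * x $ j - ?X x $ j * x $ i \<noteq> 0"
    using hamiltonian_not_radial_on_open_set [OF F U p] by blast
  define V where "V = U \<inter> {y. ?X y $ i * y $ j - ?X y $ j * y $ i \<noteq> 0}"
  have "open {y. ?X y $ i * y $ j - ?X y $ j * y $ i \<noteq> 0}"
    by (intro open_Collect_neq continuous_intros continuous_hamiltonian)
  then have V: "open V" "x \<in> V" using U x by (auto simp: V_def)
  have ind: "independent_pair y (?X y)" if "y \<in> V" for y
    using that independent_pair_if_minor_nonzero [of "?X y" i y j] by (auto simp: V_def)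
  have line: "eval4 F (y + z *s ?X y) = 0" if "y \<in> V" "eval4 F y = 0" for y z
    using hamiltonian_lines_in_surface [OF F V(1) ind] G that by (auto simp: V_def)
  define q where "q = ?X x"
  have xq: "independent_pair x q" using ind V by (simp add: q_def)
  have "x \<noteq> 0" "q \<noteq> 0" using independent_pair_nonzero [OF xq] by auto
  have on_line: "eval4 F (x + z *s q) = 0" for z using line V x by (simp add: q_def)
  have xq0: "\<sigma> x q = 0"
    using swap [of x "?X x"] sigma_hamiltonian [of F x x] differential_radial [OF hom, of x] x by (simp add: q_def)
  obtain e where e: "\<sigma> x e = 1" "\<sigma> q e = 0" using dual_vector [OF xq] .
  obtain f where f: "\<sigma> q f = 1" "\<sigma> x f = 0" using dual_vector [OF independent_pair_swap [OF xq]] .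
  have dq: "differential F (x + z *s q) q = 0" for z
  proof -
    have "eval4 F ((x + z *s q) + t *s q) = poly 0 t" for t
      using on_line [of "z + t"] by (simp add: vector_sadd_rdistrib add.assoc)
    from pderiv_line [OF this] show ?thesis by simp
  qed
  have dx: "differential F (x + z *s q) x = 0" for z
    using differential_radial [OF hom, of "x + z *s q"] on_line [of z] dq [of z] by (simp add: differential_add differential_scale)
  have decomposition: "?X y = differential F y e *s x + differential F y f *s q"
    if "differential F y x = 0" "differential F y q = 0" for y
  proof -
    have "?X y \<in> plane_of x q"
      using that swap [of x "?X y"] swap [of q "?X y"]
      by (intro lagrangian_plane_maximal [OF xq xq0]) (simp_all add: sigma_hamiltonian)
    then obtain \<alpha> \<beta> where ab: "?X y = \<alpha> *s x + \<beta> *s q" unfolding plane_of_def by blast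
    then have "differential F y e = \<alpha>" "differential F y f = \<beta>"
      using e f by (simp_all add: sigma_hamiltonian [symmetric] bilinear)
    with ab show ?thesis by simp
  qed
  obtain A where A: "degree A \<le> d - 1" "coeff A (d - 1) = differential F q e" "\<And>z. differential F (x + z *s q) e = poly A z"
    using hompoly_line [OF hompoly_differential [OF hom]] by metis
  obtain B where B: "degree B \<le> d - 1" "coeff B (d - 1) = differential F q f" "\<And>z. differential F (x + z *s q) f = poly B z"
    using hompoly_line [OF hompoly_differential [OF hom]] by metis
  have X_line: "?X (x + z *s q) = poly A z *s x + poly B z *s q" for z
    using decomposition [OF dx dq] A(3) B(3) by simp
  have no_common_root: "\<not> (poly A z = 0 \<and> poly B z = 0)" for z
  proof
    assume "poly A z = 0 \<and> poly B z = 0"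
    then have "?X (x + z *s q) = 0" by (simp add: X_line)
    moreover have "x + z *s q \<noteq> 0"
      using xq unfolding independent_pair_def by (metis vector_smult_lid zero_neq_one)
    ultimately show False using hamiltonian_nonzero [OF F _ on_line] by blast
  qed
  \<comment> \<open>no common zero at infinity either, because \<open>q\<close> is itself a smooth point of the surface\<close>
  have top: "coeff A (d - 1) \<noteq> 0 \<or> coeff B (d - 1) \<noteq> 0"
  proof (rule ccontr)
    assume "\<not> ?thesis"
    then have AB: "differential F q e = 0" "differential F q f = 0" using A(2) B(2) by auto
    have at_infinity: "g q = 0" if g: "hompoly n g" "\<And>z. g (x + z *s q) = 0" for n g
    proof -
      obtain P where P: "coeff P n = g q" "\<And>z. g (x + z *s q) = poly P z"
        using hompoly_line [OF g(1)] by metis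
      then have "poly P z = 0" for z using g(2) by simp
      then have "P = 0" using poly_all_0_iff_0 by blast
      with P(1) show ?thesis by simp
    qed
    have "differential F q x = 0" "differential F q q = 0" "eval4 F q = 0"
      using at_infinity [OF hompoly_differential [OF hom]] at_infinity [OF hompoly_eval4 [OF hom]] dx dq on_line by blast+
    then have "?X q = 0" using decomposition [of q] AB by simp
    with hamiltonian_nonzero [OF F \<open>q \<noteq> 0\<close> \<open>eval4 F q = 0\<close>] show False by simp
  qed
  define w where "w = ?X' x e"
  define L1 where "L1 = [:1, \<sigma> x w:]"
  define L2 where "L2 = [:0, \<sigma> q w:]"
  have "A * L1 + B * L2 = 0"
  proof (rule poly_ext)
    fix z
    have "differential F (x + z *s q) (e + z *s ?X' x e) = 0"
    proof (rule derivative_vanishes_on_surface [OF F V \<open>x \<noteq> 0\<close> x(2),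
          where v = e and h = "\<lambda>y. eval4 F (y + z *s ?X y)" and h' = "\<lambda>v. differential F (x + z *s q) (v + z *s ?X' x v)"])
      show "differential F x e = 0" using e sigma_hamiltonian [of F x e] by (simp add: q_def)
      show "eval4 F (y + z *s ?X y) = 0" if "y \<in> V" "eval4 F y = 0" for y using line that by blast
      have "((\<lambda>y. y + z *s ?X y) has_derivative (\<lambda>v. v + z *s ?X' x v)) (at x)"
        by (intro has_derivative_add has_derivative_ident bounded_linear.has_derivative [OF _ has_derivative_hamiltonian])
           (unfold linear_conv_bounded_linear [symmetric], rule linearI,
            auto simp: Finite_Cartesian_Product.vec_eq_iff algebra_simps)
      from has_derivative_compose [OF this, of "eval4 F" "differential F (x + z *s q)"] has_derivative_eval4'
      show "((\<lambda>y. eval4 F (y + z *s ?X y)) has_derivative (\<lambda>v. differential F (x + z *s q) (v + z *s ?X' x v))) (at x)"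
        by (simp add: q_def)
    qed
    then have "differential F (x + z *s q) (e + z *s w) = 0" by (simp only: w_def)
    then have "\<sigma> (poly A z *s x + poly B z *s q) (e + z *s w) = 0"
      by (simp only: sigma_hamiltonian [symmetric] X_line)
    then show "poly (A * L1 + B * L2) z = poly 0 z"
      by (simp add: L1_def L2_def bilinear e algebra_simps)
  qed
  then have AL: "A * L1 = - (B * L2)" by (simp add: eq_neg_iff_add_eq_0)
  have "L1 \<noteq> 0" by (simp add: L1_def)
  have deg: "degree L1 \<le> 1" "degree L2 \<le> 1" by (simp_all add: L1_def L2_def)
  have low: "L = 0" if "P dvd L" "degree L \<le> 1" "coeff P (d - 1) \<noteq> 0" for P L :: "complex poly"
  proof (rule ccontr)
    assume "L \<noteq> 0"
    then have "degree P \<le> degree L" using that(1) by (intro dvd_imp_degree_le)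
    with le_degree [OF that(3)] that(2) d show False by simp
  qed
  show False
    using top
  proof
    assume cA: "coeff A (d - 1) \<noteq> 0"
    then have "A \<noteq> 0" by auto
    have "A dvd B * L2" using AL by (metis dvd_minus_iff dvd_triv_left)
    moreover have "coprime A B" using \<open>A \<noteq> 0\<close> no_common_root by (rule coprime_if_no_common_root)
    ultimately have "A dvd L2" by (simp add: coprime_dvd_mult_right_iff)
    then have "L2 = 0" using low deg cA by blast
    with AL \<open>A \<noteq> 0\<close> \<open>L1 \<noteq> 0\<close> show False by simp
  next
    assume cB: "coeff B (d - 1) \<noteq> 0"
    then have "B \<noteq> 0" by auto
    have "B dvd A * L1" using AL by simp
    moreover have "coprime B A" using \<open>B \<noteq> 0\<close> no_common_root by (intro coprime_if_no_common_root) auto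
    ultimately have "B dvd L1" by (simp add: coprime_dvd_mult_right_iff)
    then have "L1 = 0" using low deg cB by blast
    with \<open>L1 \<noteq> 0\<close> show False by simp
  qed
qed

end

section \<open>The upper bound\<close>

context symplectic_space
begin

text \<open>The second partial derivatives have degree \<open>d - 2\<close>, and each of the two factors \<open>X\<close> has degree \<open>d - 1\<close>.\<close>

lemma hompoly_second_jet:
  assumes "homogeneous4 d F" "2 \<le> d"
  shows "hompoly (3 * d - 4) (\<lambda>x. jet 2 F x (hamiltonian F x))"
proof -
  have "hompoly ((d - 1) + ((d - 1) + (d - 1 - 1)))
     (\<lambda>x. \<Sum>i\<in>UNIV. hamiltonian F x $ i * (\<Sum>j\<in>UNIV. hamiltonian F x $ j * eval4 (partial4 j (partial4 i F)) x))"
    by (intro hompoly_sum hompoly_mult hompoly_hamiltonian hompoly_eval4 homogeneous4_partial4 assms(1))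
  moreover have "(d - 1) + ((d - 1) + (d - 1 - 1)) = 3 * d - 4" using assms(2) by simp
  ultimately show ?thesis by (simp add: numeral_2_eq_2)
qed

lemma continuous_second_jet: "continuous_on S (\<lambda>x. jet 2 F x (hamiltonian F x))"
  unfolding numeral_2_eq_2 jet.simps
  by (intro continuous_intros continuous_hamiltonian continuous_eval4)

text \<open>A Lagrangian plane in the cone of the surface is invariant under \<open>X\<close>: there \<open>dF\<close> vanishes on \<open>W\<close>, so \<open>X\<close> lies in
the orthogonal complement of \<open>W\<close>, which is \<open>W\<close>.\<close>

lemma second_jet_zero_on_lagrangian:
  assumes F: "homogeneous4 d F" "2 \<le> d" and W: "lagrangian W" "\<And>x. x \<in> W \<Longrightarrow> eval4 F x = 0" and x: "x \<in> W"
  shows "jet 2 F x (hamiltonian F x) = 0"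
proof -
  obtain p q where pq: "independent_pair p q" "W = plane_of p q" "\<sigma> p q = 0" "p \<in> W" "q \<in> W"
    using lagrangian_basis [OF W(1)] .
  have sub: "vec.subspace W" by (simp add: pq(2) plane_of_altdef vec.subspace_span)
  have in_W: "u + z *s v \<in> W" if "u \<in> W" "v \<in> W" for u v z
    using that sub by (simp add: vec.subspace_add vec.subspace_scale)
  have "differential F x v = 0" if "v \<in> W" for v
  proof -
    have "eval4 F (x + z *s v) = poly 0 z" for z using W(2) in_W [OF x that] by simp
    from pderiv_line [OF this] show ?thesis by simp
  qed
  then have "\<sigma> p (hamiltonian F x) = 0" "\<sigma> q (hamiltonian F x) = 0"
    using pq(4,5) swap [of p "hamiltonian F x"] swap [of q "hamiltonian F x"] by (simp_all add: sigma_hamiltonian)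
  then have "hamiltonian F x \<in> W" using lagrangian_plane_maximal [OF pq(1,3)] pq(2) by blast
  then have "\<forall>z. eval4 F (x + z *s hamiltonian F x) = 0" using in_W [OF x] W(2) by blast
  then show ?thesis using line_in_surface_iff_jets_vanish [OF F(1)] F(2) by blast
qed

text \<open>A form that vanishes everywhere has vanishing partial derivatives, which contradicts smoothness at any point.\<close>

lemma smooth_form_nonzero:
  assumes F: "smooth_form d F"
  shows "\<exists>x. eval4 F x \<noteq> 0"
proof (rule ccontr)
  assume "\<not> ?thesis"
  then have zero: "eval4 F x = 0" for x by blast
  define x :: "complex^4" where "x = axis 1 1"
  have "x \<noteq> 0" by (simp add: x_def axis_eq_0_iff)
  then obtain i where i: "eval4 (partial4 i F) x \<noteq> 0" using F zero by (auto simp: smooth_form_def)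
  have "eval4 F (x + z *s axis i 1) = poly 0 z" for z by (simp add: zero)
  from pderiv_line [OF this] i show False by (simp add: differential_axis)
qed

text \<open>Bezout's bound for lines, by projection from \<open>c\<close>. The hyperplane spanned by \<open>V\<close> and \<open>c\<close> is the orthogonal
complement of a vector \<open>u V\<close>, which spans the intersection of \<open>V\<close> with the orthogonal complement of \<open>c\<close>.
The line \<open>a + t b\<close> meets this hyperplane at the parameter \<open>t V\<close>, and there the line in direction \<open>c\<close> meets \<open>V\<close>,
which gives a common zero of \<open>F\<close> and \<open>G\<close>.\<close>

lemma card_lagrangian_planes_le:
  assumes F: "smooth_form d F" and d: "3 \<le> d" and fin: "finite \<W>"
    and W: "\<And>W. W \<in> \<W> \<Longrightarrow> lagrangian W" "\<And>W x. W \<in> \<W> \<Longrightarrow> x \<in> W \<Longrightarrow> eval4 F x = 0"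
  shows "card \<W> \<le> d * (3 * d - 4)"
proof -
  let ?G = "\<lambda>x. jet 2 F x (hamiltonian F x)"
  have hom: "homogeneous4 d F" using F by (simp add: smooth_form_def)
  note hF = hompoly_eval4 [OF hom]
  have hG: "hompoly (3 * d - 4) ?G" using hompoly_second_jet [OF hom] d by simp
  have G_zero: "?G x = 0" if "V \<in> \<W>" "x \<in> V" for V x
    by (rule second_jet_zero_on_lagrangian [OF hom _ W(1) [OF that(1)] W(2) [OF that(1)] that(2)]) (use d in simp)

  have "\<forall>V\<in>\<W>. \<exists>p q. independent_pair p q \<and> V = plane_of p q \<and> \<sigma> p q = 0 \<and> p \<in> V \<and> q \<in> V"
    using W(1) lagrangian_basis by metis
  then obtain p q where pq: "\<And>V. V \<in> \<W> \<Longrightarrow>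
      independent_pair (p V) (q V) \<and> V = plane_of (p V) (q V) \<and> \<sigma> (p V) (q V) = 0 \<and> p V \<in> V \<and> q V \<in> V"
    by metis
  have orth: "x \<in> V \<longleftrightarrow> \<sigma> (p V) x = 0 \<and> \<sigma> (q V) x = 0" if "V \<in> \<W>" for V x
    using pq [OF that] plane_of_orthogonal [of "p V" "q V"] by blast

  have "\<exists>r. \<forall>V V'. V \<in> \<W> \<longrightarrow> V' \<in> \<W> \<longrightarrow> V \<noteq> V' \<longrightarrow> r V V' \<noteq> 0 \<and> (\<forall>x\<in>V \<inter> V'. \<exists>k. x = k *s r V V')"
    using lagrangian_intersection W(1) by metis
  then obtain r where r: "\<And>V V'. V \<in> \<W> \<Longrightarrow> V' \<in> \<W> \<Longrightarrow> V \<noteq> V' \<Longrightarrow>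
      r V V' \<noteq> 0 \<and> (\<forall>x\<in>V \<inter> V'. \<exists>k. x = k *s r V V')" by metis

  have nonzero_sigma: "\<exists>x. \<sigma> u x \<noteq> 0" if "u \<noteq> 0" for u using nondegenerate that by blast
  define pairs where "pairs = {(V, V'). V \<in> \<W> \<and> V' \<in> \<W> \<and> V \<noteq> V'}"
  have fin_pairs: "finite pairs"
    by (rule finite_subset [of _ "\<W> \<times> \<W>"]) (use fin in \<open>auto simp: pairs_def\<close>)

  \<comment> \<open>the conditions \<open>\<sigma> (r V V') c \<noteq> 0\<close> keep the planes distinct after projection\<close>
  have "\<exists>c. \<forall>f\<in>insert (eval4 F) ((\<lambda>(V, V'). \<sigma> (r V V')) ` pairs). f c \<noteq> 0"
  proof (rule common_nonzero_point)
    fix f assume f: "f \<in> insert (eval4 F) ((\<lambda>(V, V'). \<sigma> (r V V')) ` pairs)"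
    show "\<exists>d. hompoly d f" using f hF hompoly_sigma by auto
    show "\<exists>x. f x \<noteq> 0"
      using f smooth_form_nonzero [OF F] nonzero_sigma r by (auto simp: pairs_def)
  qed (use fin_pairs in simp)
  then obtain c where c_all: "\<forall>f\<in>insert (eval4 F) ((\<lambda>(V, V'). \<sigma> (r V V')) ` pairs). f c \<noteq> 0" ..
  have c: "eval4 F c \<noteq> 0" using c_all by simp
  have c': "\<sigma> (r V V') c \<noteq> 0" if "(V, V') \<in> pairs" for V V'
    using bspec [OF c_all insertI2 [OF imageI [OF that]]] by simp

  have "\<exists>a\<in>{x. \<sigma> c x \<noteq> 0}. \<forall>z. \<not> (eval4 F (a + z *s c) = 0 \<and> ?G (a + z *s c) = 0)"
  proof (rule line_without_common_zero [OF hF c continuous_eval4 continuous_second_jet])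
    \<comment> \<open>the condition \<open>\<sigma> c x \<noteq> 0\<close> keeps the lines in direction \<open>c\<close> away from the vertex of the cone\<close>
    show "open {x. \<sigma> c x \<noteq> 0}" by (intro open_Collect_neq continuous_sigma continuous_intros)
    have "eval4 F 0 = 0" using eval4_scale [OF hom, of 0 0] d by (simp add: zero_power)
    then have "c \<noteq> 0" using c by auto
    then show "{x. \<sigma> c x \<noteq> 0} \<noteq> {}" using nonzero_sigma by blast
    show "a + z *s c \<in> {x. \<sigma> c x \<noteq> 0}" if "a \<in> {x. \<sigma> c x \<noteq> 0}" for a z
      using that by (simp add: bilinear self)
    fix y e assume y: "y \<in> {x. \<sigma> c x \<noteq> 0}" "eval4 F y = 0" "(e::real) > 0"
    have "y \<noteq> 0" using y(1) by auto
    then obtain x where "x \<in> ball y e" "eval4 F x = 0" "?G x \<noteq> 0"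
      using second_jet_not_zero_on_open_set [OF F d open_ball, of y y e] y by auto
    then show "\<exists>x. dist x y < e \<and> eval4 F x = 0 \<and> ?G x \<noteq> 0" by (auto simp: dist_commute)
  qed
  then obtain a where a: "\<And>z. \<not> (eval4 F (a + z *s c) = 0 \<and> ?G (a + z *s c) = 0)" by blast

  define u where "u V = \<sigma> (q V) c *s p V - \<sigma> (p V) c *s q V" for V
  have u_in: "u V \<in> V" if "V \<in> \<W>" for V
    using pq [OF that] swap [of "q V" "p V"] by (simp add: orth [OF that] u_def bilinear self)
  have u_c: "\<sigma> (u V) c = 0" for V by (simp add: u_def bilinear)
  have c_notin: "\<sigma> (p V) c \<noteq> 0 \<or> \<sigma> (q V) c \<noteq> 0" if "V \<in> \<W>" for V
    using c W(2) [OF that] orth [OF that, of c] by blast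
  have u_nonzero: "u V \<noteq> 0" if "V \<in> \<W>" for V
  proof
    assume "u V = 0"
    then have "\<sigma> (q V) c *s p V + (- \<sigma> (p V) c) *s q V = 0"
      by (simp add: u_def Finite_Cartesian_Product.vec_eq_iff)
    with pq [OF that] have "\<sigma> (q V) c = 0 \<and> - \<sigma> (p V) c = 0" unfolding independent_pair_def by blast
    with c_notin [OF that] show False by simp
  qed
  have meets: "\<exists>z. x + z *s c \<in> V" if V: "V \<in> \<W>" and x: "\<sigma> (u V) x = 0" for V x
  proof -
    have *: "\<sigma> (q V) c * \<sigma> (p V) x = \<sigma> (p V) c * \<sigma> (q V) x"
      using x by (simp add: u_def bilinear)
    consider "\<sigma> (p V) c \<noteq> 0" | "\<sigma> (q V) c \<noteq> 0" using c_notin [OF V] by blast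
    then show ?thesis
    proof cases
      case 1
      then show ?thesis using *
        by (intro exI [of _ "- \<sigma> (p V) x / \<sigma> (p V) c"]) (simp add: orth [OF V] bilinear field_simps)
    next
      case 2
      then show ?thesis using *
        by (intro exI [of _ "- \<sigma> (q V) x / \<sigma> (q V) c"]) (simp add: orth [OF V] bilinear field_simps)
    qed
  qed
  have u_a: "\<sigma> (u V) a \<noteq> 0" if "V \<in> \<W>" for V
    using meets [OF that, of a] a W(2) [OF that] G_zero [OF that] by blast

  \<comment> \<open>\<open>w V V'\<close> is orthogonal to \<open>b\<close> exactly if \<open>t V = t V'\<close>\<close>
  define w where "w V V' = \<sigma> (u V') a *s u V - \<sigma> (u V) a *s u V'" for V V'
  have w_nonzero: "w V V' \<noteq> 0" if VV: "(V, V') \<in> pairs" for V V'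
  proof
    assume "w V V' = 0"
    have V: "V \<in> \<W>" "V' \<in> \<W>" "V \<noteq> V'" using VV by (auto simp: pairs_def)
    have "\<sigma> (u V') a *s u V = \<sigma> (u V) a *s u V'" using \<open>w V V' = 0\<close> by (simp add: w_def)
    then have "u V = (\<sigma> (u V) a / \<sigma> (u V') a) *s u V'"
      using u_a [OF V(2)] unfolding Finite_Cartesian_Product.vec_eq_iff vector_smult_component
      by (simp add: nonzero_eq_divide_eq mult.commute)
    moreover have "k *s u V' \<in> V'" for k using u_in [OF V(2)] by (simp add: orth [OF V(2)] scale_right)
    ultimately have "u V \<in> V'" by metis
    then obtain k where k: "u V = k *s r V V'" using r [OF V] u_in [OF V(1)] by blast
    then have "k * \<sigma> (r V V') c = 0" using u_c [of V] by (simp add: scale_left)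
    then have "k = 0" using c' [OF VV] by simp
    with k u_nonzero [OF V(1)] show False by simp
  qed
  have "\<exists>b. \<forall>f\<in>(\<lambda>V. \<sigma> (u V)) ` \<W> \<union> (\<lambda>(V, V'). \<sigma> (w V V')) ` pairs. f b \<noteq> 0"
  proof (rule common_nonzero_point)
    fix f assume f: "f \<in> (\<lambda>V. \<sigma> (u V)) ` \<W> \<union> (\<lambda>(V, V'). \<sigma> (w V V')) ` pairs"
    show "\<exists>d. hompoly d f" using f hompoly_sigma by auto
    show "\<exists>x. f x \<noteq> 0" using f nonzero_sigma u_nonzero w_nonzero by auto
  qed (use fin fin_pairs in simp)
  then obtain b where b_all: "\<forall>f\<in>(\<lambda>V. \<sigma> (u V)) ` \<W> \<union> (\<lambda>(V, V'). \<sigma> (w V V')) ` pairs. f b \<noteq> 0" ..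
  have b: "\<sigma> (u V) b \<noteq> 0" if "V \<in> \<W>" for V
    using bspec [OF b_all UnI1 [OF imageI [OF that]]] .
  have b': "\<sigma> (w V V') b \<noteq> 0" if "(V, V') \<in> pairs" for V V'
    using bspec [OF b_all UnI2 [OF imageI [OF that]]] by simp

  define t where "t V = - \<sigma> (u V) a / \<sigma> (u V) b" for V
  have "inj_on t \<W>"
  proof (rule inj_onI, rule ccontr)
    fix V V' assume V: "V \<in> \<W>" "V' \<in> \<W>" "t V = t V'" "V \<noteq> V'"
    then have "\<sigma> (w V V') b = 0" using b [OF V(1)] b [OF V(2)]
      by (simp add: t_def w_def bilinear field_simps)
    with b' V show False by (auto simp: pairs_def)
  qed
  moreover have "card (t ` \<W>) \<le> d * (3 * d - 4)"
  proof -
    obtain P where P: "weight_le d P" "coeff P d = [:eval4 F c:]"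
      "\<And>t z. eval4 F (a + t *s b + z *s c) = poly (specialize t P) z"
      using hF unfolding hompoly_def by metis
    obtain Q where Q: "weight_le (3 * d - 4) Q"
      "\<And>t z. ?G (a + t *s b + z *s c) = poly (specialize t Q) z"
      using hG unfolding hompoly_def by metis
    show ?thesis
    proof (rule card_common_root_parameters [OF P(1) _ Q(1)])
      show "coeff P d \<noteq> 0" using P(2) c by simp
      show "\<not> (poly (specialize 0 P) z = 0 \<and> poly (specialize 0 Q) z = 0)" for z
        using a [of z] P(3) [of 0 z] Q(2) [of 0 z] by simp
      fix s assume "s \<in> t ` \<W>"
      then obtain V where V: "V \<in> \<W>" "s = t V" by blast
      have "\<sigma> (u V) (a + s *s b) = 0" using b [OF V(1)] V(2) by (simp add: t_def bilinear)
      then obtain z where "a + s *s b + z *s c \<in> V" using meets [OF V(1)] by blast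
      then show "\<exists>z. poly (specialize s P) z = 0 \<and> poly (specialize s Q) z = 0"
        using W(2) [OF V(1)] G_zero [OF V(1)] P(3) Q(2) by metis
    qed
  qed
  ultimately show ?thesis by (simp add: card_image)
qed

text \<open>Every finite set of Lagrangian planes in the cone satisfies the bound, which also makes the set of all of them finite.\<close>

lemma involutive_lines_bound:
  assumes S: "smooth_surface d S" and d: "3 \<le> d"
  shows "finite (involutive_lines \<sigma> S) \<and> card (involutive_lines \<sigma> S) \<le> 3 * d^2 - 4 * d"
proof -
  obtain F where F: "homogeneous4 d F" "S = zero_locus F"
    "\<forall>x. x \<noteq> 0 \<and> eval4 F x = 0 \<longrightarrow> (\<exists>i. eval4 (partial4 i F) x \<noteq> 0)"
    using S unfolding smooth_surface_def by blast
  have smooth: "smooth_form d F" using F by (simp add: smooth_form_def)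
  define \<W> where "\<W> = {W. lagrangian W \<and> (\<forall>x\<in>W. eval4 F x = 0)}"
  have lines: "involutive_lines \<sigma> S = projectivization ` \<W>"
    using projectivization_subset_zero_locus_iff [OF F(1)] d
    by (auto simp: involutive_lines_def involutive_line_iff \<W>_def F(2) lagrangian_def is_plane_def)
  have bound: "card V \<le> d * (3 * d - 4)" if "finite V" "V \<subseteq> \<W>" for V
    using that by (intro card_lagrangian_planes_le [OF smooth d]) (auto simp: \<W>_def)
  have "finite \<W> \<and> card \<W> \<le> d * (3 * d - 4)"
    using finite_if_finite_subsets_card_bdd [of \<W>] bound by blast
  moreover have "d * (3 * d - 4) = 3 * d^2 - 4 * d"
    by (simp add: diff_mult_distrib2 power2_eq_square)
  ultimately show ?thesis
    unfolding lines using card_image_le [of \<W> projectivization] by auto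
qed

end

section \<open>Fermat surfaces\<close>

lemma homogeneous4_add: "homogeneous4 d F \<Longrightarrow> homogeneous4 d G \<Longrightarrow> homogeneous4 d (F + G)"
  unfolding homogeneous4_def by (metis add.right_neutral in_keys_iff lookup_add add_0)

lemma homogeneous4_sum: "(\<And>a. a \<in> A \<Longrightarrow> homogeneous4 d (F a)) \<Longrightarrow> homogeneous4 d (\<Sum>a\<in>A. F a)"
  by (induction A rule: infinite_finite_induct) (auto intro: homogeneous4_add simp: homogeneous4_def [of d 0])

lemma homogeneous4_single: "(\<Sum>i\<in>UNIV. m $ i) = d \<Longrightarrow> homogeneous4 d (Poly_Mapping.single m c)"
  by (simp add: homogeneous4_def)

lemma mon_plus_axis: "mon (m + axis i 1) x = x $ i * mon m x"
proof -
  have "mon (m + axis i 1) x = (\<Prod>j\<in>UNIV. (x $ j) ^ (m $ j) * (if j = i then x $ i else 1))"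
    unfolding mon_def by (rule prod.cong) (auto simp: axis_def)
  also have "\<dots> = mon m x * x $ i" by (simp add: prod.distrib mon_def prod.delta)
  finally show ?thesis by simp
qed

text \<open>Multiplication by a linear form shifts exponent vectors by unit vectors, so the power is built up one factor at a
time from single monomials.\<close>

lemma linear_form_power:
  "\<exists>F. homogeneous4 d F \<and> (\<forall>x. eval4 F x = (\<Sum>i\<in>UNIV. x $ i * a $ i) ^ d)"
proof (induction d)
  case 0
  have "homogeneous4 0 (Poly_Mapping.single 0 1)" by (rule homogeneous4_single) simp
  moreover have "eval4 (Poly_Mapping.single 0 1) x = 1" for x
    by (simp only: eval4_single) (simp add: mon_def)
  ultimately show ?case by (intro exI [of _ "Poly_Mapping.single 0 1"]) (simp only: power_0 simp_thms)
next
  case (Suc d)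
  then obtain F where F: "homogeneous4 d F" "\<And>x. eval4 F x = (\<Sum>i\<in>UNIV. x $ i * a $ i) ^ d" by blast
  let ?G = "\<Sum>i\<in>UNIV. \<Sum>m\<in>Poly_Mapping.keys F. Poly_Mapping.single (m + axis i 1) (a $ i * Poly_Mapping.lookup F m)"
  have "homogeneous4 (Suc d) ?G"
  proof (intro homogeneous4_sum homogeneous4_single)
    fix i m assume "m \<in> Poly_Mapping.keys F"
    with F(1) have "(\<Sum>j\<in>UNIV. m $ j) = d" by (simp add: homogeneous4_def)
    then show "(\<Sum>j\<in>UNIV. (m + axis i 1) $ j) = Suc d" by (simp add: sum.distrib axis_def)
  qed
  moreover have "eval4 ?G x = (\<Sum>i\<in>UNIV. x $ i * a $ i) ^ Suc d" for x
  proof -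
    have "eval4 ?G x = (\<Sum>i\<in>UNIV. x $ i * a $ i * eval4 F x)"
      by (simp add: eval4_sum eval4_single mon_plus_axis eval4_superset [OF finite_keys order_refl, of F]
          sum_distrib_left mult_ac del: One_nat_def)
    then show ?thesis by (simp add: F(2) flip: sum_distrib_right)
  qed
  ultimately show ?case by blast
qed

context symplectic_space
begin

lemma sum_left: "\<sigma> (\<Sum>i\<in>A. f i) v = (\<Sum>i\<in>A. \<sigma> (f i) v)"
  by (induction A rule: infinite_finite_induct) (simp_all add: add_left)

lemma sigma_coordinates: "\<sigma> x e = (\<Sum>i\<in>UNIV. x $ i * (\<chi> i. \<sigma> (axis i 1) e) $ i)"
proof -
  have "\<sigma> (\<Sum>i\<in>UNIV. x $ i *s axis i 1) e = (\<Sum>i\<in>UNIV. x $ i * \<sigma> (axis i 1) e)"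
    by (simp add: sum_left scale_left)
  then show ?thesis by (simp add: basis_expansion)
qed

text \<open>A symplectic basis: \<open>\<complex>\<^sup>4\<close> is the orthogonal sum of two hyperbolic planes.\<close>

lemma darboux_basis:
  obtains e1 e2 e3 e4 where "\<sigma> e1 e2 = 1" "\<sigma> e3 e4 = 1"
    "\<sigma> e1 e3 = 0" "\<sigma> e1 e4 = 0" "\<sigma> e2 e3 = 0" "\<sigma> e2 e4 = 0"
proof -
  define e1 :: "complex^4" where "e1 = axis 1 1"
  have "e1 \<noteq> 0" by (simp add: e1_def axis_eq_0_iff)
  then obtain y where y: "\<sigma> e1 y \<noteq> 0" using nondegenerate by blast
  define e2 where "e2 = (1 / \<sigma> e1 y) *s y"
  have e12: "\<sigma> e1 e2 = 1" using y by (simp add: e2_def scale_right)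
  then have e21: "\<sigma> e2 e1 = - 1" using swap [of e2 e1] by simp
  \<comment> \<open>projection along the span of \<open>e1\<close> and \<open>e2\<close> onto its orthogonal complement\<close>
  define proj where "proj x = x - \<sigma> e1 x *s e2 + \<sigma> e2 x *s e1" for x
  have proj: "\<sigma> e1 (proj x) = 0" "\<sigma> e2 (proj x) = 0" for x
    by (simp_all add: proj_def bilinear self e12 e21)
  obtain x where x: "x \<notin> plane_of e1 e2" using exists_outside_plane by blast
  define e3 where "e3 = proj x"
  have "e3 \<noteq> 0"
  proof
    assume "e3 = 0"
    then have "x = (- \<sigma> e2 x) *s e1 + \<sigma> e1 x *s e2"
      by (simp add: e3_def proj_def Finite_Cartesian_Product.vec_eq_iff algebra_simps)
    with x show False unfolding plane_of_def by blast
  qed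
  then obtain w where w: "\<sigma> e3 w \<noteq> 0" using nondegenerate by blast
  have e3: "\<sigma> e1 e3 = 0" "\<sigma> e2 e3 = 0" by (simp_all add: e3_def proj)
  then have "\<sigma> e3 e1 = 0" "\<sigma> e3 e2 = 0" using swap [of e3 e1] swap [of e3 e2] by simp_all
  then have "\<sigma> e3 (proj ((1 / \<sigma> e3 w) *s w)) = 1" using w by (simp add: proj_def bilinear)
  with e12 e3 proj show thesis by (intro that [of e1 e2 e3 "proj ((1 / \<sigma> e3 w) *s w)"]) auto
qed

text \<open>The Fermat form in Darboux coordinates. The vectors \<open>e1 + y e2\<close> and \<open>e3 + z e4\<close> with \<open>y\<^sup>d = z\<^sup>d = -1\<close> are zeros
of it that lie in the two orthogonal hyperbolic planes, so the plane that they span is Lagrangian and lies in the cone.\<close>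

lemma fermat_surface:
  assumes d: "3 \<le> d"
  shows "\<exists>S. smooth_surface d S \<and> (\<exists>A\<subseteq>involutive_lines \<sigma> S. card A = d^2)"
proof -
  obtain e1 e2 e3 e4 where e: "\<sigma> e1 e2 = 1" "\<sigma> e3 e4 = 1"
    "\<sigma> e1 e3 = 0" "\<sigma> e1 e4 = 0" "\<sigma> e2 e3 = 0" "\<sigma> e2 e4 = 0"
    by (rule darboux_basis)
  have e': "\<sigma> e2 e1 = - 1" "\<sigma> e4 e3 = - 1" "\<sigma> e3 e1 = 0" "\<sigma> e4 e1 = 0" "\<sigma> e3 e2 = 0" "\<sigma> e4 e2 = 0"
    using e swap [of e2 e1] swap [of e4 e3] swap [of e3 e1] swap [of e4 e1] swap [of e3 e2] swap [of e4 e2]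
    by simp_all
  note eval_e = e e' self bilinear
  define l1 l2 l3 l4 where "l1 x = \<sigma> x e2" and "l2 x = \<sigma> x (- e1)" and "l3 x = \<sigma> x e4" and "l4 x = \<sigma> x (- e3)" for x
  note l_defs = l1_def l2_def l3_def l4_def
  have "\<exists>F. homogeneous4 d F \<and> (\<forall>x. eval4 F x = \<sigma> x v ^ d)" for v
    using linear_form_power [of d "\<chi> i. \<sigma> (axis i 1) v"] by (simp only: sigma_coordinates [of _ v, symmetric])
  then obtain T where T: "\<And>v. homogeneous4 d (T v)" "\<And>v x. eval4 (T v) x = \<sigma> x v ^ d" by metis
  define F where "F = T e2 + T (- e1) + T e4 + T (- e3)"
  have hom: "homogeneous4 d F" unfolding F_def by (intro homogeneous4_add T)
  have F: "eval4 F x = l1 x ^ d + l2 x ^ d + l3 x ^ d + l4 x ^ d" for x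
    by (simp add: F_def eval4_add T l_defs)
  have zero_if: "x = 0" if "l1 x = 0" "l2 x = 0" "l3 x = 0" "l4 x = 0" for x
  proof (rule nondegenerate)
    fix y
    define b :: "4 \<Rightarrow> complex^4" where "b i = (if i = 1 then e1 else if i = 2 then e2 else if i = 3 then e3 else e4)" for i
    have sum_b: "(\<Sum>i\<in>UNIV. c i *s b i) = c 1 *s e1 + c 2 *s e2 + c 3 *s e3 + c 4 *s e4" for c
      by (simp add: sum_4 b_def)
    have "\<forall>i. c i = 0" if "(\<Sum>i\<in>UNIV. c i *s b i) = 0" for c
    proof -
      have "\<sigma> e1 (\<Sum>i\<in>UNIV. c i *s b i) = 0" "\<sigma> e2 (\<Sum>i\<in>UNIV. c i *s b i) = 0"
        "\<sigma> e3 (\<Sum>i\<in>UNIV. c i *s b i) = 0" "\<sigma> e4 (\<Sum>i\<in>UNIV. c i *s b i) = 0"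
        by (simp_all only: that zero)
      then show ?thesis unfolding sum_b by (simp add: eval_e forall_4)
    qed
    then obtain c where "y = (\<Sum>i\<in>UNIV. c i *s b i)" using span_four by blast
    then show "\<sigma> x y = 0" using that unfolding sum_b l_defs by (simp add: bilinear)
  qed
  have differential_F: "differential F x v = of_nat d * (l1 x ^ (d - 1) * l1 v + l2 x ^ (d - 1) * l2 v
      + l3 x ^ (d - 1) * l3 v + l4 x ^ (d - 1) * l4 v)" for x v
  proof -
    have "eval4 F (x + z *s v) = poly ([:l1 x, l1 v:] ^ d + [:l2 x, l2 v:] ^ d + [:l3 x, l3 v:] ^ d + [:l4 x, l4 v:] ^ d) z" for z
      by (simp add: F l_defs add_left scale_left)
    from pderiv_line [OF this] show ?thesis
      by (simp add: pderiv_add pderiv_power pderiv_pCons algebra_simps)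
  qed
  have smooth: "\<exists>i. eval4 (partial4 i F) x \<noteq> 0" if "x \<noteq> 0" for x
  proof (rule ccontr)
    assume "\<not> ?thesis"
    then have "differential F x v = 0" for v by (simp add: differential_def)
    then have "differential F x e1 = 0" "differential F x e2 = 0" "differential F x e3 = 0" "differential F x e4 = 0" by blast+
    then have "l1 x = 0" "l2 x = 0" "l3 x = 0" "l4 x = 0"
      unfolding differential_F using d by (simp_all add: l_defs eval_e)
    with zero_if that show False by blast
  qed
  have "eval4 F e1 \<noteq> 0" using d by (simp add: F l_defs eval_e zero_power)
  then have "F \<noteq> 0" by auto
  with hom smooth have surface: "smooth_surface d (zero_locus F)" unfolding smooth_surface_def by blast

  define Z where "Z = {z :: complex. z ^ d = - 1}"
  have "card Z = d" unfolding Z_def using d by (intro card_nth_roots) auto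
  define W where "W = (\<lambda>(y, z). plane_of (e1 + y *s e2) (e3 + z *s e4))"
  have ind: "independent_pair (e1 + y *s e2) (e3 + z *s e4)" for y z
    unfolding independent_pair_def
  proof (intro allI impI)
    fix \<alpha> \<beta> assume *: "\<alpha> *s (e1 + y *s e2) + \<beta> *s (e3 + z *s e4) = 0"
    have "l1 (\<alpha> *s (e1 + y *s e2) + \<beta> *s (e3 + z *s e4)) = \<alpha>"
      "l3 (\<alpha> *s (e1 + y *s e2) + \<beta> *s (e3 + z *s e4)) = \<beta>"
      by (simp_all add: l_defs eval_e)
    then show "\<alpha> = 0 \<and> \<beta> = 0" unfolding * by (simp add: l_defs)
  qed
  have plane: "is_plane (W yz)" for yz using ind is_plane_iff by (auto simp: W_def split: prod.split)
  then have subspace: "vec.subspace (W yz)" for yz by (simp add: is_plane_def)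
  have lag: "lagrangian (W yz)" for yz
    unfolding lagrangian_def using plane [of yz]
    by (auto simp: W_def plane_of_def eval_e split: prod.splits)
  have on_surface: "eval4 F x = 0" if s: "yz \<in> Z \<times> Z" and x: "x \<in> W yz" for yz x
  proof -
    obtain y z where "yz = (y, z)" by (cases yz)
    with s have yz: "yz = (y, z)" "y ^ d = - 1" "z ^ d = - 1" by (auto simp: Z_def)
    obtain \<alpha> \<beta> where "x = \<alpha> *s (e1 + y *s e2) + \<beta> *s (e3 + z *s e4)"
      using x unfolding yz(1) W_def plane_of_def prod.case by blast
    then show ?thesis by (simp add: F l_defs eval_e power_mult_distrib yz)
  qed
  have "inj_on (\<lambda>yz. projectivization (W yz)) (Z \<times> Z)"
  proof (rule inj_onI)
    fix s t assume "projectivization (W s) = projectivization (W t)"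
    then have W_eq: "W s = W t" using union_projectivization [OF subspace] by metis
    obtain y z y' z' where st: "s = (y, z)" "t = (y', z')" by fastforce
    have "e1 + y *s e2 \<in> W t" "e3 + z *s e4 \<in> W t"
      unfolding W_eq [symmetric] by (simp_all add: st W_def in_plane_of)
    then obtain \<alpha> \<beta> \<gamma> \<delta> where
      1: "e1 + y *s e2 = \<alpha> *s (e1 + y' *s e2) + \<beta> *s (e3 + z' *s e4)" and
      2: "e3 + z *s e4 = \<gamma> *s (e1 + y' *s e2) + \<delta> *s (e3 + z' *s e4)"
      by (auto simp: st W_def plane_of_def)
    have "\<alpha> = 1" "y = \<alpha> * y'" using arg_cong [OF 1, of l1] arg_cong [OF 1, of l2] by (simp_all add: l_defs eval_e)
    moreover have "\<delta> = 1" "z = \<delta> * z'" using arg_cong [OF 2, of l3] arg_cong [OF 2, of l4] by (simp_all add: l_defs eval_e)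
    ultimately show "s = t" by (simp add: st)
  qed
  then have "card ((\<lambda>yz. projectivization (W yz)) ` (Z \<times> Z)) = d^2"
    using \<open>card Z = d\<close> by (simp add: card_image card_cartesian_product power2_eq_square)
  moreover have "(\<lambda>yz. projectivization (W yz)) ` (Z \<times> Z) \<subseteq> involutive_lines \<sigma> (zero_locus F)"
  proof
    fix L assume "L \<in> (\<lambda>yz. projectivization (W yz)) ` (Z \<times> Z)"
    then obtain yz where yz: "yz \<in> Z \<times> Z" "L = projectivization (W yz)" by blast
    then have "L \<subseteq> zero_locus F"
      using on_surface projectivization_subset_zero_locus_iff [OF hom _ subspace [of yz]] d by auto
    with lag yz show "L \<in> involutive_lines \<sigma> (zero_locus F)"
      by (auto simp: involutive_lines_def involutive_line_iff)
  qed
  ultimately show ?thesis using surface by blast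
qed

lemma max_involutive_upper:
  assumes "3 \<le> d"
  shows "max_involutive \<sigma> d \<le> enat (3 * d^2 - 4 * d)"
  unfolding max_involutive_def
  by (rule SUP_least) (use involutive_lines_bound [OF _ assms] in \<open>auto simp: ecount_def\<close>)

lemma max_involutive_lower:
  assumes "3 \<le> d"
  shows "enat (d^2) \<le> max_involutive \<sigma> d"
proof -
  obtain S A where S: "smooth_surface d S" "A \<subseteq> involutive_lines \<sigma> S" "card A = d^2"
    using fermat_surface [OF assms] by blast
  have "card A \<le> card (involutive_lines \<sigma> S)"
    using involutive_lines_bound [OF S(1) assms] S(2) by (intro card_mono) auto
  then have "enat (d^2) \<le> ecount (involutive_lines \<sigma> S)"
    using involutive_lines_bound [OF S(1) assms] S(3) by (simp add: ecount_def)
  also have "\<dots> \<le> max_involutive \<sigma> d"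
    unfolding max_involutive_def using S(1) by (intro SUP_upper) auto
  finally show ?thesis .
qed

lemma max_involutive_ratio:
  assumes "3 \<le> d"
  shows "ereal_of_enat (max_involutive \<sigma> d) / ereal (real d ^ 2) \<in> {1..3}"
proof -
  obtain n where n: "max_involutive \<sigma> d = enat n" "n \<le> 3 * d^2 - 4 * d"
    using max_involutive_upper [OF assms] by (cases "max_involutive \<sigma> d") auto
  have "d^2 \<le> n" using max_involutive_lower [OF assms] n by simp
  have "real n \<le> 3 * real d ^ 2"
  proof -
    have "n \<le> 3 * d^2" using n(2) by linarith
    then have "real n \<le> real (3 * d^2)" by (rule of_nat_mono)
    then show ?thesis by simp
  qed
  moreover have "real d ^ 2 \<le> real n" using \<open>d^2 \<le> n\<close> by (metis of_nat_le_iff of_nat_power)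
  moreover have "0 < real d ^ 2" using assms by simp
  ultimately show ?thesis using n(1) by (simp add: one_ereal_def field_simps numeral_eq_ereal)
qed

end

theorem theorem2:
  fixes \<sigma> :: "complex^4 \<Rightarrow> complex^4 \<Rightarrow> complex"
  assumes "symplectic \<sigma>"
  shows "(\<forall>d\<ge>3. \<forall>S. smooth_surface d S \<longrightarrow>
            finite (involutive_lines \<sigma> S) \<and> card (involutive_lines \<sigma> S) \<le> 3 * d^2 - 4 * d)
       \<and> (\<forall>d\<ge>3. max_involutive \<sigma> d \<le> enat (3 * d^2 - 4 * d))
       \<and> limsup (\<lambda>d. ereal_of_enat (max_involutive \<sigma> d) / ereal (real d ^ 2)) \<in> {1..3}"
proof -
  interpret symplectic_space \<sigma> using assms by unfold_locales
  have "\<forall>\<^sub>F d in sequentially. ereal_of_enat (max_involutive \<sigma> d) / ereal (real d ^ 2) \<in> {1..3}"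
    using eventually_ge_at_top [of 3] by eventually_elim (rule max_involutive_ratio)
  then have "limsup (\<lambda>d. ereal_of_enat (max_involutive \<sigma> d) / ereal (real d ^ 2)) \<in> {1..3}"
    unfolding atLeastAtMost_iff eventually_conj_iff
    by (intro conjI le_Limsup Limsup_bounded) auto
  then show ?thesis
    using involutive_lines_bound max_involutive_upper by blast
qed

end
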